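(* Let $K$ be a field of characteristic zero and fix an integer $g\ge 3$. Suppose that every CPA-structure on the free-nilpotent Lie algebra $F_{g,3}$ over $K$ is central. Then for every integer $c\ge 3$, every CPA-structure on the free-nilpotent Lie algebra $F_{g,c}$ over $K$ is central.
   Context: A commutative post-Lie algebra structure, or CPA-structure, on a Lie algebra $\mathfrak{g}$ over $K$ is a $K$-bilinear product $x\cdot y$ on the vector space $\mathfrak{g}$ such that for all $x,y,z\in\mathfrak{g}$: (1) $x\cdot y=y\cdot x$; (2) $[x,y]\cdot z=x\cdot(y\cdot z)-y\cdot(x\cdot z)$; (3) $x\cdot[y,z]=[x\cdot y,z]+[y,x\cdot z]$. A CPA-structure on a nilpotent Lie algebra $\mathfrak{g}$ is called central if $\mathfrak{g}\cdot\mathfrak{g}\subseteq Z(\mathfrak{g})$, where $Z(\mathfrak{g})$ is the center of $\mathfrak{g}$. The lower central series of a Lie algebra is $\mathfrak{g}^1=\mathfrak{g}$, $\mathfrak{g}^{i+1}=[\mathfrak{g},\mathfrak{g}^i]$. If $F_g$ is the free Lie algebra over $K$ on $g$ generators, the free-nilpotent Lie algebra with $g$ generators and nilpotency class $c$ is $F_{g,c}=F_g/F_g^{c+1}$. *)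

theory Defs
  imports "HOL-Algebra.Algebraic_Closure_Type"
begin

section \<open>Nonassociative algebras and Lie algebras over a field\<close>

text \<open>
  The base field is a type \<open>'k\<close> of class \<open>field\<close>; it enters the library locale
  \<^locale>\<open>module\<close> through \<^const>\<open>ring_of_type_algebra\<close>. As in the library locale
  \<^locale>\<open>algebra\<close>, the product is the \<open>mult\<close> component of the record, so the Lie bracket
  \<open>[x, y]\<close> is written \<open>x \<otimes> y\<close>. The \<open>one\<close> component plays no role.
\<close>

locale nonassoc_algebra =
  module "ring_of_type_algebra :: 'k ring" A
  for A :: "('k::field, 'v) module" (structure) +
  assumes mult_closed:
      "\<lbrakk>x \<in> carrier A; y \<in> carrier A\<rbrakk> \<Longrightarrow> x \<otimes> y \<in> carrier A"
    and mult_add_left: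
      "\<lbrakk>x \<in> carrier A; y \<in> carrier A; z \<in> carrier A\<rbrakk> \<Longrightarrow> (x \<oplus> y) \<otimes> z = x \<otimes> z \<oplus> y \<otimes> z"
    and mult_add_right:
      "\<lbrakk>x \<in> carrier A; y \<in> carrier A; z \<in> carrier A\<rbrakk> \<Longrightarrow> x \<otimes> (y \<oplus> z) = x \<otimes> y \<oplus> x \<otimes> z"
    and mult_smult_left:
      "\<lbrakk>x \<in> carrier A; y \<in> carrier A\<rbrakk> \<Longrightarrow> (a \<odot> x) \<otimes> y = a \<odot> (x \<otimes> y)"
    and mult_smult_right:
      "\<lbrakk>x \<in> carrier A; y \<in> carrier A\<rbrakk> \<Longrightarrow> x \<otimes> (a \<odot> y) = a \<odot> (x \<otimes> y)"

locale lie_algebra = nonassoc_algebra L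
  for L :: "('k::field, 'v) module" (structure) +
  assumes alternating: "x \<in> carrier L \<Longrightarrow> x \<otimes> x = \<zero>"
    and jacobi:
      "\<lbrakk>x \<in> carrier L; y \<in> carrier L; z \<in> carrier L\<rbrakk> \<Longrightarrow>
        x \<otimes> (y \<otimes> z) \<oplus> y \<otimes> (z \<otimes> x) \<oplus> z \<otimes> (x \<otimes> y) = \<zero>"

definition center :: "('k::field, 'v) module \<Rightarrow> 'v set" where
  "center L = {z \<in> carrier L. \<forall>x\<in>carrier L. z \<otimes>\<^bsub>L\<^esub> x = \<zero>\<^bsub>L\<^esub>}"

definition linear_span :: "('k::field, 'v) module \<Rightarrow> 'v set \<Rightarrow> 'v set" where
  "linear_span L S = \<Inter>{N. submodule N (ring_of_type_algebra :: 'k ring) L \<and> S \<subseteq> N}"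

text \<open>
  \<open>[U, V]\<close> for subspaces \<open>U\<close>, \<open>V\<close> is the linear span of all brackets.
\<close>

definition bracket_space :: "('k::field, 'v) module \<Rightarrow> 'v set \<Rightarrow> 'v set \<Rightarrow> 'v set" where
  "bracket_space L U V = linear_span L {u \<otimes>\<^bsub>L\<^esub> v | u v. u \<in> U \<and> v \<in> V}"

text \<open>
  The lower central series starts at index 1; the value at index 0 is a convention.
\<close>

fun lower_central :: "('k::field, 'v) module \<Rightarrow> nat \<Rightarrow> 'v set" where
  "lower_central L 0 = carrier L"
| "lower_central L (Suc 0) = carrier L"
| "lower_central L (Suc (Suc i)) = bracket_space L (carrier L) (lower_central L (Suc i))"

section \<open>Ideals and quotients\<close>

definition algebra_ideal :: "'v set \<Rightarrow> ('k::field, 'v) module \<Rightarrow> bool" where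
  "algebra_ideal I A \<longleftrightarrow> submodule I (ring_of_type_algebra :: 'k ring) A \<and>
     (\<forall>a\<in>carrier A. \<forall>x\<in>I. a \<otimes>\<^bsub>A\<^esub> x \<in> I \<and> x \<otimes>\<^bsub>A\<^esub> a \<in> I)"

definition generated_ideal :: "('k::field, 'v) module \<Rightarrow> 'v set \<Rightarrow> 'v set" where
  "generated_ideal A S = \<Inter>{I. algebra_ideal I A \<and> S \<subseteq> I}"

text \<open>
  The quotient by an ideal, with the cosets as elements; compare \<^const>\<open>FactRing\<close>. For an
  ideal \<open>I\<close> one has \<open>(I +> x) \<otimes> (I +> y) = I +> x \<otimes> y\<close> and \<open>a \<odot> (I +> x) = I +> a \<odot> x\<close>.
\<close>

definition quotient_algebra :: "('k::field, 'v) module \<Rightarrow> 'v set \<Rightarrow> ('k, 'v set) module" where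
  "quotient_algebra A I =
     \<lparr>carrier = a_rcosets\<^bsub>A\<^esub> I, monoid.mult = rcoset_mult A I, one = I +>\<^bsub>A\<^esub> \<one>\<^bsub>A\<^esub>,
      ring.zero = I, add = set_add A,
      module.smult = (\<lambda>a C. \<Union>x\<in>C. I +>\<^bsub>A\<^esub> (a \<odot>\<^bsub>A\<^esub> x))\<rparr>"

section \<open>Free Lie algebras and free-nilpotent Lie algebras\<close>

text \<open>
  The free nonassociative algebra on the generators \<open>0, \<dots>, g - 1\<close> has as basis the free magma
  on these generators. Its elements are the finitely supported functions from the magma to the
  field; as every basis element other than a generator is uniquely a product \<open>s \<cdot> t\<close>, the
  coefficient of the product \<open>f \<cdot> h\<close> at \<open>s \<cdot> t\<close> is \<open>f s * h t\<close>.
\<close>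

datatype (leaves: 'x) magma = Gen 'x | Node "'x magma" "'x magma"

definition free_nonassoc :: "nat \<Rightarrow> ('k::field, nat magma \<Rightarrow> 'k) module" where
  "free_nonassoc g =
     \<lparr>carrier = {f. finite {t. f t \<noteq> 0} \<and> (\<forall>t. f t \<noteq> 0 \<longrightarrow> leaves t \<subseteq> {..<g})},
      monoid.mult = (\<lambda>f h t. case t of Gen _ \<Rightarrow> 0 | Node s u \<Rightarrow> f s * h u), one = (\<lambda>_. 0),
      ring.zero = (\<lambda>_. 0), add = (\<lambda>f h t. f t + h t),
      module.smult = (\<lambda>a f t. a * f t)\<rparr>"

definition lie_relators :: "('k::field, 'v) module \<Rightarrow> 'v set" where
  "lie_relators A = {x \<otimes>\<^bsub>A\<^esub> x | x. x \<in> carrier A} \<union>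
     {x \<otimes>\<^bsub>A\<^esub> (y \<otimes>\<^bsub>A\<^esub> z) \<oplus>\<^bsub>A\<^esub> y \<otimes>\<^bsub>A\<^esub> (z \<otimes>\<^bsub>A\<^esub> x) \<oplus>\<^bsub>A\<^esub> z \<otimes>\<^bsub>A\<^esub> (x \<otimes>\<^bsub>A\<^esub> y) | x y z.
        x \<in> carrier A \<and> y \<in> carrier A \<and> z \<in> carrier A}"

definition free_lie :: "nat \<Rightarrow> ('k::field, (nat magma \<Rightarrow> 'k) set) module" where
  "free_lie g = quotient_algebra (free_nonassoc g)
     (generated_ideal (free_nonassoc g) (lie_relators (free_nonassoc g)))"

definition free_nilpotent_lie ::
    "nat \<Rightarrow> nat \<Rightarrow> ('k::field, (nat magma \<Rightarrow> 'k) set set) module" where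
  "free_nilpotent_lie g c = quotient_algebra (free_lie g) (lower_central (free_lie g) (c + 1))"

section \<open>Commutative post-Lie algebra structures\<close>

locale cpa_structure = lie_algebra L
  for L :: "('k::field, 'v) module" (structure) +
  fixes cpa :: "'v \<Rightarrow> 'v \<Rightarrow> 'v" (infixl \<open>\<cdot>\<close> 70)
  assumes cpa_closed:
      "\<lbrakk>x \<in> carrier L; y \<in> carrier L\<rbrakk> \<Longrightarrow> x \<cdot> y \<in> carrier L"
    and cpa_add_left:
      "\<lbrakk>x \<in> carrier L; y \<in> carrier L; z \<in> carrier L\<rbrakk> \<Longrightarrow> (x \<oplus> y) \<cdot> z = (x \<cdot> z) \<oplus> (y \<cdot> z)"
    and cpa_add_right:
      "\<lbrakk>x \<in> carrier L; y \<in> carrier L; z \<in> carrier L\<rbrakk> \<Longrightarrow> x \<cdot> (y \<oplus> z) = (x \<cdot> y) \<oplus> (x \<cdot> z)"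
    and cpa_smult_left:
      "\<lbrakk>x \<in> carrier L; y \<in> carrier L\<rbrakk> \<Longrightarrow> (a \<odot> x) \<cdot> y = a \<odot> (x \<cdot> y)"
    and cpa_smult_right:
      "\<lbrakk>x \<in> carrier L; y \<in> carrier L\<rbrakk> \<Longrightarrow> x \<cdot> (a \<odot> y) = a \<odot> (x \<cdot> y)"
    and cpa_commute:
      "\<lbrakk>x \<in> carrier L; y \<in> carrier L\<rbrakk> \<Longrightarrow> x \<cdot> y = y \<cdot> x"
    and cpa_bracket_left:
      "\<lbrakk>x \<in> carrier L; y \<in> carrier L; z \<in> carrier L\<rbrakk> \<Longrightarrow>
        (x \<otimes> y) \<cdot> z = (x \<cdot> (y \<cdot> z)) \<ominus> (y \<cdot> (x \<cdot> z))"
    and cpa_bracket_right: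
      "\<lbrakk>x \<in> carrier L; y \<in> carrier L; z \<in> carrier L\<rbrakk> \<Longrightarrow>
        x \<cdot> (y \<otimes> z) = ((x \<cdot> y) \<otimes> z) \<oplus> (y \<otimes> (x \<cdot> z))"

definition central_cpa :: "('k::field, 'v) module \<Rightarrow> ('v \<Rightarrow> 'v \<Rightarrow> 'v) \<Rightarrow> bool" where
  "central_cpa L cpa \<longleftrightarrow> (\<forall>x\<in>carrier L. \<forall>y\<in>carrier L. cpa x y \<in> center L)"

section \<open>The free-nilpotent Lie algebras are Lie algebras\<close>

lemma scalars_simps [simp]:
  "carrier (ring_of_type_algebra :: 'k::field ring) = UNIV"
  "monoid.mult (ring_of_type_algebra :: 'k::field ring) = (*)"
  "monoid.one (ring_of_type_algebra :: 'k::field ring) = 1"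
  "ring.zero (ring_of_type_algebra :: 'k::field ring) = 0"
  "ring.add (ring_of_type_algebra :: 'k::field ring) = (+)"
  by (auto simp: ring_of_type_algebra_def)

lemma nonassoc_algebra_free_nonassoc:
  "nonassoc_algebra (free_nonassoc g :: ('k::field, nat magma \<Rightarrow> 'k) module)"
proof -
  let ?A = "free_nonassoc g :: ('k, nat magma \<Rightarrow> 'k) module"
  have neg: "(\<lambda>t. - f t) \<in> carrier ?A" if "f \<in> carrier ?A" for f
    using that by (auto simp: free_nonassoc_def)
  have add: "(\<lambda>t. f t + h t) \<in> carrier ?A" if "f \<in> carrier ?A" "h \<in> carrier ?A" for f h
  proof -
    have sub: "{t. f t + h t \<noteq> 0} \<subseteq> {t. f t \<noteq> 0} \<union> {t. h t \<noteq> 0}" by auto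
    show ?thesis using that finite_subset[OF sub]
      by (auto simp: free_nonassoc_def) (metis add_0 subsetD lessThan_iff)
  qed
  have smult: "(\<lambda>t. a * f t) \<in> carrier ?A" if "f \<in> carrier ?A" for a f
  proof -
    have sub: "{t. a * f t \<noteq> 0} \<subseteq> {t. f t \<noteq> 0}" by auto
    show ?thesis using that finite_subset[OF sub] by (auto simp: free_nonassoc_def)
  qed
  have mult: "f \<otimes>\<^bsub>?A\<^esub> h \<in> carrier ?A" if "f \<in> carrier ?A" "h \<in> carrier ?A" for f h
  proof -
    have sub: "{t. (f \<otimes>\<^bsub>?A\<^esub> h) t \<noteq> 0} \<subseteq> (\<lambda>(s, u). Node s u) ` ({t. f t \<noteq> 0} \<times> {t. h t \<noteq> 0})"
    proof
      fix t assume "t \<in> {t. (f \<otimes>\<^bsub>?A\<^esub> h) t \<noteq> 0}"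
      then show "t \<in> (\<lambda>(s, u). Node s u) ` ({t. f t \<noteq> 0} \<times> {t. h t \<noteq> 0})"
        by (cases t) (auto simp: free_nonassoc_def)
    qed
    have fin: "finite {t. (f \<otimes>\<^bsub>?A\<^esub> h) t \<noteq> 0}"
      by (rule finite_subset[OF sub]) (use that in \<open>auto simp: free_nonassoc_def\<close>)
    have "leaves t \<subseteq> {..<g}" if "(f \<otimes>\<^bsub>?A\<^esub> h) t \<noteq> 0" for t
    proof (cases t)
      case (Node s u)
      with that have "f s \<noteq> 0" "h u \<noteq> 0" by (auto simp: free_nonassoc_def)
      with \<open>f \<in> carrier ?A\<close> \<open>h \<in> carrier ?A\<close> Node show ?thesis
        unfolding free_nonassoc_def by simp
    qed (use that in \<open>simp add: free_nonassoc_def\<close>)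
    with fin show ?thesis
      by (auto simp: free_nonassoc_def)
  qed
  have ops: "f \<oplus>\<^bsub>?A\<^esub> h = (\<lambda>t. f t + h t)" "\<zero>\<^bsub>?A\<^esub> = (\<lambda>_. 0)" for f h
    by (simp_all add: free_nonassoc_def)
  have zero: "(\<lambda>_. 0) \<in> carrier ?A" by (simp add: free_nonassoc_def)
  have ab: "abelian_group ?A"
  proof (rule abelian_groupI)
    show "\<exists>y\<in>carrier ?A. y \<oplus>\<^bsub>?A\<^esub> f = \<zero>\<^bsub>?A\<^esub>" if "f \<in> carrier ?A" for f
      using neg[OF that] by (intro bexI[of _ "\<lambda>t. - f t"]) (auto simp: ops)
  qed (auto simp: ops add zero add_ac)
  show ?thesis
  proof (intro nonassoc_algebra.intro nonassoc_algebra_axioms.intro moduleI)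
    show "cring (ring_of_type_algebra :: 'k ring)" by (rule cring_from_type_algebra)
    show "abelian_group ?A" by (rule ab)
    show "a \<odot>\<^bsub>?A\<^esub> f \<in> carrier ?A" if "f \<in> carrier ?A" for a f
      using smult[OF that, of a] by (simp add: free_nonassoc_def)
    show "f \<otimes>\<^bsub>?A\<^esub> h \<in> carrier ?A" if "f \<in> carrier ?A" "h \<in> carrier ?A" for f h
      using mult[OF that] .
  qed (auto simp: free_nonassoc_def algebra_simps fun_eq_iff split: magma.splits)
qed

lemma (in nonassoc_algebra) ideal_abelian_subgroup:
  assumes "algebra_ideal I A"
  shows "abelian_subgroup I A"
  using assms abelian_group_axioms
  by (auto simp: algebra_ideal_def submodule_def intro!: abelian_subgroupI3 additive_subgroupI)

lemma (in nonassoc_algebra) mult_zero_left [simp]: "x \<in> carrier A \<Longrightarrow> \<zero> \<otimes> x = \<zero>"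
  using mult_add_left[of "\<zero>" "\<zero>" x] mult_closed[of "\<zero>" x] by (simp add: add.l_cancel_one')

lemma (in nonassoc_algebra) mult_zero_right [simp]: "x \<in> carrier A \<Longrightarrow> x \<otimes> \<zero> = \<zero>"
  using mult_add_right[of x "\<zero>" "\<zero>"] mult_closed[of x "\<zero>"] by (simp add: add.l_cancel_one')

lemma (in nonassoc_algebra) quotient_simps:
  assumes "algebra_ideal I A"
  shows "carrier (quotient_algebra A I) = {I +> x | x. x \<in> carrier A}"
    and "\<zero>\<^bsub>quotient_algebra A I\<^esub> = I +> \<zero>"
    and "\<lbrakk>x \<in> carrier A; y \<in> carrier A\<rbrakk> \<Longrightarrow>
           (I +> x) \<oplus>\<^bsub>quotient_algebra A I\<^esub> (I +> y) = I +> (x \<oplus> y)"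
    and "\<lbrakk>x \<in> carrier A; y \<in> carrier A\<rbrakk> \<Longrightarrow>
           (I +> x) \<otimes>\<^bsub>quotient_algebra A I\<^esub> (I +> y) = I +> (x \<otimes> y)"
    and "x \<in> carrier A \<Longrightarrow> a \<odot>\<^bsub>quotient_algebra A I\<^esub> (I +> x) = I +> (a \<odot> x)"
proof -
  interpret I: abelian_subgroup I A by (rule ideal_abelian_subgroup[OF assms])
  have I_mult: "a \<otimes> x \<in> I" "x \<otimes> a \<in> I" if "a \<in> carrier A" "x \<in> I" for a x
    using assms that by (auto simp: algebra_ideal_def)
  have I_smult: "a \<odot> x \<in> I" if "x \<in> I" for a x
    using submodule.smult_closed[of I "ring_of_type_algebra :: 'k ring" A] assms that
    by (simp add: algebra_ideal_def)
  have coset: "I +> y = I +> x" if "x \<in> carrier A" "y \<in> I +> x" for x y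
    by (rule I.a_repr_independence'[symmetric]) (use that in auto)
  have memE: "\<exists>h\<in>I. y = h \<oplus> x" if "y \<in> I +> x" for x y
    using that by (auto simp: a_r_coset_def')
  have memI: "h \<oplus> x \<in> I +> x" if "h \<in> I" for x h
    using that by (auto simp: a_r_coset_def')
  show "carrier (quotient_algebra A I) = {I +> x | x. x \<in> carrier A}"
    by (auto simp: quotient_algebra_def A_RCOSETS_def')
  show "\<zero>\<^bsub>quotient_algebra A I\<^esub> = I +> \<zero>"
    using I.a_subset by (simp add: quotient_algebra_def)
  show "(I +> x) \<oplus>\<^bsub>quotient_algebra A I\<^esub> (I +> y) = I +> (x \<oplus> y)"
    if "x \<in> carrier A" "y \<in> carrier A"
    using I.a_rcos_sum[OF that] by (simp add: quotient_algebra_def)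
  show "a \<odot>\<^bsub>quotient_algebra A I\<^esub> (I +> x) = I +> (a \<odot> x)" if x: "x \<in> carrier A"
  proof -
    have "I +> (a \<odot> y) = I +> (a \<odot> x)" if "y \<in> I +> x" for y
    proof (rule coset)
      obtain h where h: "h \<in> I" "y = h \<oplus> x" using memE \<open>y \<in> I +> x\<close> by blast
      then have "a \<odot> y = a \<odot> h \<oplus> a \<odot> x" using x I.a_Hcarr by (simp add: smult_r_distr)
      then show "a \<odot> y \<in> I +> (a \<odot> x)" using memI I_smult h by simp
    qed (use x in simp)
    then have "(\<Union>y\<in>I +> x. I +> (a \<odot> y)) = I +> (a \<odot> x)"
      using I.a_rcos_self[OF x] by (intro SUP_eq_const) blast+
    then show ?thesis by (simp add: quotient_algebra_def)
  qed
  show "(I +> x) \<otimes>\<^bsub>quotient_algebra A I\<^esub> (I +> y) = I +> (x \<otimes> y)"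
    if x: "x \<in> carrier A" and y: "y \<in> carrier A"
  proof -
    have "I +> (x' \<otimes> y') = I +> (x \<otimes> y)" if "x' \<in> I +> x" "y' \<in> I +> y" for x' y'
    proof (rule coset)
      obtain h where h: "h \<in> I" "x' = h \<oplus> x" using memE \<open>x' \<in> I +> x\<close> by blast
      obtain k where k: "k \<in> I" "y' = k \<oplus> y" using memE \<open>y' \<in> I +> y\<close> by blast
      note carr = x y I.a_Hcarr[OF h(1)] I.a_Hcarr[OF k(1)]
      have "x' \<otimes> y' = (h \<otimes> (k \<oplus> y) \<oplus> x \<otimes> k) \<oplus> x \<otimes> y"
        using carr mult_add_left[of h x "k \<oplus> y"] mult_add_right[of x k y]
        by (simp add: h(2) k(2) mult_closed a_assoc)
      moreover have "h \<otimes> (k \<oplus> y) \<oplus> x \<otimes> k \<in> I"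
        using carr h k I_mult by auto
      ultimately show "x' \<otimes> y' \<in> I +> (x \<otimes> y)" using memI by simp
    qed (use x y mult_closed in simp)
    then have "(\<Union>x'\<in>I +> x. \<Union>y'\<in>I +> y. I +> (x' \<otimes> y')) = I +> (x \<otimes> y)"
      using I.a_rcos_self[OF x] I.a_rcos_self[OF y] by (intro SUP_eq_const) blast+
    then show ?thesis by (simp add: quotient_algebra_def rcoset_mult_def)
  qed
qed

lemma (in nonassoc_algebra) nonassoc_algebra_quotient:
  assumes "algebra_ideal I A"
  shows "nonassoc_algebra (quotient_algebra A I)"
proof -
  note simps = quotient_simps[OF assms]
  let ?Q = "quotient_algebra A I"
  have rep: "\<exists>x\<in>carrier A. C = I +> x" if "C \<in> carrier ?Q" for C
    using that simps(1) by auto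
  have I_closed: "I +> x \<in> carrier ?Q" if "x \<in> carrier A" for x
    using that simps(1) by auto
  have ab: "abelian_group ?Q"
  proof (rule abelian_groupI)
    fix C assume "C \<in> carrier ?Q"
    then obtain x where x: "x \<in> carrier A" "C = I +> x" using rep by blast
    show "\<exists>D\<in>carrier ?Q. D \<oplus>\<^bsub>?Q\<^esub> C = \<zero>\<^bsub>?Q\<^esub>"
      using x by (intro bexI[of _ "I +> (\<ominus> x)"] I_closed) (simp_all add: simps(2,3) l_neg)
    show "\<zero>\<^bsub>?Q\<^esub> \<oplus>\<^bsub>?Q\<^esub> C = C"
      using x by (simp add: simps(2,3))
  next
    fix C D assume "C \<in> carrier ?Q" "D \<in> carrier ?Q"
    then obtain x y where xy: "x \<in> carrier A" "C = I +> x" "y \<in> carrier A" "D = I +> y"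
      using rep by metis
    show "C \<oplus>\<^bsub>?Q\<^esub> D \<in> carrier ?Q" using xy by (simp add: simps(3) I_closed)
    show "C \<oplus>\<^bsub>?Q\<^esub> D = D \<oplus>\<^bsub>?Q\<^esub> C" using xy by (simp add: simps(3) a_comm)
    fix E assume "E \<in> carrier ?Q"
    then obtain z where z: "z \<in> carrier A" "E = I +> z" using rep by metis
    show "C \<oplus>\<^bsub>?Q\<^esub> D \<oplus>\<^bsub>?Q\<^esub> E = C \<oplus>\<^bsub>?Q\<^esub> (D \<oplus>\<^bsub>?Q\<^esub> E)"
      using xy z by (simp add: simps(3) a_assoc)
  qed (simp add: simps(2) I_closed)
  show ?thesis
  proof (intro nonassoc_algebra.intro nonassoc_algebra_axioms.intro moduleI ab
      cring_from_type_algebra)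
    fix C :: "'v set" and a b :: 'k assume "C \<in> carrier ?Q"
    then obtain x where x: "x \<in> carrier A" "C = I +> x" using rep by blast
    show "a \<odot>\<^bsub>?Q\<^esub> C \<in> carrier ?Q" using x by (simp add: simps(5) I_closed)
    show "(a \<oplus>\<^bsub>ring_of_type_algebra\<^esub> b) \<odot>\<^bsub>?Q\<^esub> C = a \<odot>\<^bsub>?Q\<^esub> C \<oplus>\<^bsub>?Q\<^esub> b \<odot>\<^bsub>?Q\<^esub> C"
      using x smult_l_distr[of a b x] by (simp add: simps(3,5))
    show "(a \<otimes>\<^bsub>ring_of_type_algebra\<^esub> b) \<odot>\<^bsub>?Q\<^esub> C = a \<odot>\<^bsub>?Q\<^esub> (b \<odot>\<^bsub>?Q\<^esub> C)"
      using x smult_assoc1[of a b x] by (simp add: simps(5))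
    show "\<one>\<^bsub>ring_of_type_algebra\<^esub> \<odot>\<^bsub>?Q\<^esub> C = C"
      using x smult_one[of x] by (simp add: simps(5))
    fix D assume "D \<in> carrier ?Q"
    then obtain y where y: "y \<in> carrier A" "D = I +> y" using rep by blast
    show "a \<odot>\<^bsub>?Q\<^esub> (C \<oplus>\<^bsub>?Q\<^esub> D) = a \<odot>\<^bsub>?Q\<^esub> C \<oplus>\<^bsub>?Q\<^esub> a \<odot>\<^bsub>?Q\<^esub> D"
      using x y smult_r_distr[of a x y] by (simp add: simps(3,5))
    show "C \<otimes>\<^bsub>?Q\<^esub> D \<in> carrier ?Q"
      using x y by (simp add: simps(4) mult_closed I_closed)
    show "(a \<odot>\<^bsub>?Q\<^esub> C) \<otimes>\<^bsub>?Q\<^esub> D = a \<odot>\<^bsub>?Q\<^esub> (C \<otimes>\<^bsub>?Q\<^esub> D)"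
      using x y by (simp add: simps(4,5) mult_closed mult_smult_left)
    show "C \<otimes>\<^bsub>?Q\<^esub> (a \<odot>\<^bsub>?Q\<^esub> D) = a \<odot>\<^bsub>?Q\<^esub> (C \<otimes>\<^bsub>?Q\<^esub> D)"
      using x y by (simp add: simps(4,5) mult_closed mult_smult_right)
    fix E assume "E \<in> carrier ?Q"
    then obtain z where z: "z \<in> carrier A" "E = I +> z" using rep by blast
    show "(C \<oplus>\<^bsub>?Q\<^esub> D) \<otimes>\<^bsub>?Q\<^esub> E = C \<otimes>\<^bsub>?Q\<^esub> E \<oplus>\<^bsub>?Q\<^esub> D \<otimes>\<^bsub>?Q\<^esub> E"
      using x y z by (simp add: simps(3,4) mult_closed mult_add_left)
    show "C \<otimes>\<^bsub>?Q\<^esub> (D \<oplus>\<^bsub>?Q\<^esub> E) = C \<otimes>\<^bsub>?Q\<^esub> D \<oplus>\<^bsub>?Q\<^esub> C \<otimes>\<^bsub>?Q\<^esub> E"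
      using x y z by (simp add: simps(3,4) mult_closed mult_add_right)
  qed
qed

lemma (in nonassoc_algebra) submodule_Inter:
  assumes "\<And>N. N \<in> \<N> \<Longrightarrow> submodule N (ring_of_type_algebra :: 'k ring) A" "\<N> \<noteq> {}"
  shows "submodule (\<Inter>\<N>) (ring_of_type_algebra :: 'k ring) A"
proof (rule submoduleI)
  note sub = submoduleE[OF assms(1)]
  show "\<Inter>\<N> \<subseteq> carrier A" using sub(1) assms(2) by blast
  show "\<zero> \<in> \<Inter>\<N>"
  proof
    fix N assume N: "N \<in> \<N>"
    then obtain x where "x \<in> N" using sub(2) by blast
    with N show "\<zero> \<in> N"
      using sub(1,3,5)[OF N] r_neg[of x] by (metis subsetD)
  qed
  show "\<ominus> a \<in> \<Inter>\<N>" if "a \<in> \<Inter>\<N>" for a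
    using that sub(3) by simp
  show "a \<oplus> b \<in> \<Inter>\<N>" if "a \<in> \<Inter>\<N>" "b \<in> \<Inter>\<N>" for a b
    using that sub(5) by simp
  show "a \<odot> x \<in> \<Inter>\<N>" if "x \<in> \<Inter>\<N>" for a x
    using that sub(4) by simp
qed

lemma (in nonassoc_algebra) generated_ideal:
  assumes "S \<subseteq> carrier A"
  shows "algebra_ideal (generated_ideal A S) A" and "S \<subseteq> generated_ideal A S"
proof -
  have carr: "algebra_ideal (carrier A) A"
    by (simp add: algebra_ideal_def carrier_is_submodule mult_closed)
  show "algebra_ideal (generated_ideal A S) A"
    unfolding algebra_ideal_def
  proof
    show "submodule (generated_ideal A S) (ring_of_type_algebra :: 'k ring) A"
      unfolding generated_ideal_def
      by (rule submodule_Inter) (use carr assms in \<open>auto simp: algebra_ideal_def\<close>)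
  qed (auto simp: generated_ideal_def algebra_ideal_def)
  show "S \<subseteq> generated_ideal A S" by (auto simp: generated_ideal_def)
qed

lemma (in nonassoc_algebra) linear_span:
  assumes "S \<subseteq> carrier A"
  shows "submodule (linear_span A S) (ring_of_type_algebra :: 'k ring) A"
    and "S \<subseteq> linear_span A S"
    and "\<lbrakk>submodule N (ring_of_type_algebra :: 'k ring) A; S \<subseteq> N\<rbrakk> \<Longrightarrow> linear_span A S \<subseteq> N"
proof -
  show "submodule (linear_span A S) (ring_of_type_algebra :: 'k ring) A"
    unfolding linear_span_def
    by (rule submodule_Inter) (use carrier_is_submodule assms in auto)
qed (auto simp: linear_span_def)

lemma lie_algebra_free_lie: "lie_algebra (free_lie g :: ('k::field, _) module)"
proof -
  define A where "A = (free_nonassoc g :: ('k, nat magma \<Rightarrow> 'k) module)"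
  define I where "I = generated_ideal A (lie_relators A)"
  interpret nonassoc_algebra A unfolding A_def by (rule nonassoc_algebra_free_nonassoc)
  have rel: "lie_relators A \<subseteq> carrier A" by (auto simp: lie_relators_def mult_closed)
  have ideal: "algebra_ideal I A" unfolding I_def by (rule generated_ideal(1)[OF rel])
  interpret I: abelian_subgroup I A by (rule ideal_abelian_subgroup[OF ideal])
  have I_rel: "lie_relators A \<subseteq> I" unfolding I_def by (rule generated_ideal(2)[OF rel])
  note simps = quotient_simps[OF ideal]
  have rep: "\<exists>x\<in>carrier A. C = I +>\<^bsub>A\<^esub> x" if "C \<in> carrier (quotient_algebra A I)" for C
    using that simps(1) by auto
  have "lie_algebra (quotient_algebra A I)"
  proof (intro lie_algebra.intro lie_algebra_axioms.intro nonassoc_algebra_quotient[OF ideal])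
    let ?Q = "quotient_algebra A I"
    fix C assume "C \<in> carrier ?Q"
    then obtain x where x: "x \<in> carrier A" "C = I +>\<^bsub>A\<^esub> x" using rep by blast
    have "x \<otimes>\<^bsub>A\<^esub> x \<in> I" using x I_rel by (auto simp: lie_relators_def)
    then show "C \<otimes>\<^bsub>?Q\<^esub> C = \<zero>\<^bsub>?Q\<^esub>"
      using x I.a_subset by (simp add: simps(2,4) I.a_rcos_const)
    fix D assume "D \<in> carrier ?Q"
    then obtain y where y: "y \<in> carrier A" "D = I +>\<^bsub>A\<^esub> y" using rep by blast
    fix E assume "E \<in> carrier ?Q"
    then obtain z where z: "z \<in> carrier A" "E = I +>\<^bsub>A\<^esub> z" using rep by blast
    have "x \<otimes>\<^bsub>A\<^esub> (y \<otimes>\<^bsub>A\<^esub> z) \<oplus>\<^bsub>A\<^esub> y \<otimes>\<^bsub>A\<^esub> (z \<otimes>\<^bsub>A\<^esub> x) \<oplus>\<^bsub>A\<^esub> z \<otimes>\<^bsub>A\<^esub> (x \<otimes>\<^bsub>A\<^esub> y) \<in> I"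
      using x y z I_rel unfolding lie_relators_def by blast
    then show "C \<otimes>\<^bsub>?Q\<^esub> (D \<otimes>\<^bsub>?Q\<^esub> E) \<oplus>\<^bsub>?Q\<^esub> D \<otimes>\<^bsub>?Q\<^esub> (E \<otimes>\<^bsub>?Q\<^esub> C) \<oplus>\<^bsub>?Q\<^esub> E \<otimes>\<^bsub>?Q\<^esub> (C \<otimes>\<^bsub>?Q\<^esub> D) = \<zero>\<^bsub>?Q\<^esub>"
      using x y z I.a_subset by (simp add: simps(2,3,4) mult_closed I.a_rcos_const)
  qed
  then show ?thesis by (simp add: free_lie_def A_def I_def)
qed

lemma (in lie_algebra) lie_algebra_quotient:
  assumes ideal: "algebra_ideal I L"
  shows "lie_algebra (quotient_algebra L I)"
proof (intro lie_algebra.intro lie_algebra_axioms.intro nonassoc_algebra_quotient[OF ideal])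
  let ?Q = "quotient_algebra L I"
  note simps = quotient_simps[OF ideal]
  have rep: "\<exists>x\<in>carrier L. C = I +> x" if "C \<in> carrier ?Q" for C
    using that simps(1) by auto
  fix C assume "C \<in> carrier ?Q"
  then obtain x where x: "x \<in> carrier L" "C = I +> x" using rep by blast
  then show "C \<otimes>\<^bsub>?Q\<^esub> C = \<zero>\<^bsub>?Q\<^esub>" by (simp add: simps(2,4) alternating)
  fix D assume "D \<in> carrier ?Q"
  then obtain y where y: "y \<in> carrier L" "D = I +> y" using rep by blast
  fix E assume "E \<in> carrier ?Q"
  then obtain z where z: "z \<in> carrier L" "E = I +> z" using rep by blast
  show "C \<otimes>\<^bsub>?Q\<^esub> (D \<otimes>\<^bsub>?Q\<^esub> E) \<oplus>\<^bsub>?Q\<^esub> D \<otimes>\<^bsub>?Q\<^esub> (E \<otimes>\<^bsub>?Q\<^esub> C) \<oplus>\<^bsub>?Q\<^esub> E \<otimes>\<^bsub>?Q\<^esub> (C \<otimes>\<^bsub>?Q\<^esub> D) = \<zero>\<^bsub>?Q\<^esub>"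
    using x y z by (simp add: simps(2,3,4) mult_closed jacobi)
qed

lemma (in lie_algebra) anticommutative:
  assumes x: "x \<in> carrier L" and y: "y \<in> carrier L"
  shows "x \<otimes> y = \<ominus> (y \<otimes> x)"
proof -
  have "(x \<oplus> y) \<otimes> (x \<oplus> y) = x \<otimes> y \<oplus> y \<otimes> x"
    using x y mult_add_left[of x y "x \<oplus> y"] mult_add_right[of x x y] mult_add_right[of y x y]
    by (simp add: mult_closed alternating[of x] alternating[of y])
  moreover have "(x \<oplus> y) \<otimes> (x \<oplus> y) = \<zero>" using x y by (intro alternating) simp
  ultimately have "x \<otimes> y \<oplus> y \<otimes> x = \<zero>" by simp
  then show ?thesis using x y mult_closed minus_equality by metis
qed

lemma (in lie_algebra) lower_central_ideal: "algebra_ideal (lower_central L i) L"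
proof (induction L\<equiv>L i rule: lower_central.induct)
  case (3 i)
  let ?N = "lower_central L (Suc i)" and ?S = "{u \<otimes> v | u v. u \<in> carrier L \<and> v \<in> lower_central L (Suc i)}"
  have N: "?N \<subseteq> carrier L" using 3 submoduleE(1) by (auto simp: algebra_ideal_def)
  then have S: "?S \<subseteq> carrier L" using mult_closed by auto
  have "linear_span L ?S \<subseteq> ?N"
    by (rule linear_span(3)[OF S]) (use 3 in \<open>auto simp: algebra_ideal_def\<close>)
  note sub = linear_span(1)[OF S] linear_span(2)[OF S] this
  have left: "a \<otimes> x \<in> linear_span L ?S" if "a \<in> carrier L" "x \<in> linear_span L ?S" for a x
    using that sub by blast
  have "x \<otimes> a \<in> linear_span L ?S" if "a \<in> carrier L" "x \<in> linear_span L ?S" for a x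
    using left[OF that] anticommutative[of x a] submoduleE(1,3)[OF sub(1)] that by auto
  with left sub(1) show ?case
    by (simp add: bracket_space_def algebra_ideal_def)
qed (simp_all add: algebra_ideal_def carrier_is_submodule mult_closed)

lemma lie_algebra_free_nilpotent_lie: "lie_algebra (free_nilpotent_lie g c :: ('k::field, _) module)"
  unfolding free_nilpotent_lie_def
  using lie_algebra_free_lie lie_algebra.lie_algebra_quotient lie_algebra.lower_central_ideal
  by blast

end

theory Submission
  imports Defs "HOL-Library.Function_Algebras"
begin

text \<open>
  Elements of the free Lie algebra are tested on their noncommutative power series. By the
  Dynkin--Specht--Wever identity, which is where characteristic zero enters, bracketing the series
  of a homogeneous element of degree \<open>d\<close> gives back \<open>d\<close> times that element. Hence the \<open>n\<close>-th term
  of the lower central series consists of the elements whose series vanishes on words of length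
  less than \<open>n\<close>, and no form of the Poincare--Birkhoff--Witt theorem is needed.

  A product on \<open>F\<^bsub>g,c\<^esub>\<close> preserves the lower central series, so it descends to \<open>F\<^bsub>g,3\<^esub>\<close>, and the
  hypothesis places \<open>x \<cdot> y\<close> in the third term. Suppose that all products lie in the \<open>n\<close>-th term with
  \<open>3 \<le> n < c\<close>. Then \<open>x \<cdot> (y \<cdot> z)\<close> lies in the term of index \<open>2 n - 1 \<ge> n + 2\<close>, hence so does
  \<open>z \<cdot> [x\<^sub>i, x\<^sub>j] = [z \<cdot> x\<^sub>i, x\<^sub>j] + [x\<^sub>i, z \<cdot> x\<^sub>j]\<close>. With at least three letters, comparing words
  forces the leading part of every \<open>z \<cdot> x\<^sub>i\<close> to vanish, so all products lie in the next term.
\<close>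

section \<open>Noncommutative power series\<close>

fun conv :: "('a list \<Rightarrow> 'k::comm_ring_1) \<Rightarrow> ('a list \<Rightarrow> 'k) \<Rightarrow> 'a list \<Rightarrow> 'k" where
  "conv p q [] = p [] * q []"
| "conv p q (i # w) = p [] * q (i # w) + conv (\<lambda>v. p (i # v)) q w"

section \<open>Bilinearity and associativity of the concatenation product\<close>

lemma conv_add_left: "conv (p + p') q = conv p q + conv p' q"
proof
  show "conv (p + p') q w = (conv p q + conv p' q) w" for w
  proof (induction w arbitrary: p p')
    case (Cons i w)
    from Cons.IH[of "\<lambda>v. p (i # v)" "\<lambda>v. p' (i # v)"] show ?case
      by (simp add: algebra_simps plus_fun_def)
  qed (simp add: algebra_simps)
qed

lemma conv_scale_left: "conv (\<lambda>v. a * p v) q = (\<lambda>w. a * conv p q w)"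
proof
  show "conv (\<lambda>v. a * p v) q w = a * conv p q w" for w
    by (induction w arbitrary: p) (simp_all add: algebra_simps)
qed

lemma conv_add_right: "conv p (q + q') = conv p q + conv p q'"
proof
  show "conv p (q + q') w = (conv p q + conv p q') w" for w
    by (induction w arbitrary: p) (simp_all add: algebra_simps)
qed

lemma conv_scale_right: "conv p (\<lambda>v. a * q v) = (\<lambda>w. a * conv p q w)"
proof
  show "conv p (\<lambda>v. a * q v) w = a * conv p q w" for w
    by (induction w arbitrary: p) (simp_all add: algebra_simps)
qed

lemma conv_zero_left [simp]: "conv 0 q = 0"
  using conv_scale_left[of 0 0 q] by (simp add: zero_fun_def)

lemma conv_zero_right [simp]: "conv p 0 = 0"
  using conv_scale_right[of p 0 0] by (simp add: zero_fun_def)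

lemma conv_diff_left: "conv (p - p') q = conv p q - conv p' q"
  using conv_add_left[of "p - p'" p' q] by simp

lemma conv_diff_right: "conv p (q - q') = conv p q - conv p q'"
  using conv_add_right[of p "q - q'" q'] by simp

lemma conv_assoc: "conv (conv p q) r = conv p (conv q r)"
proof
  show "conv (conv p q) r w = conv p (conv q r) w" for w
  proof (induction w arbitrary: p)
    case (Cons i w)
    \<comment> \<open>A first letter of the product is taken from \<open>q\<close> when
      \<open>p\<close> contributes the empty word, and from \<open>p\<close> otherwise. The
      induction is general in \<open>p\<close>, so it applies to the shifted
      \<open>p\<close>.\<close>
    have "(\<lambda>v. conv p q (i # v)) = (\<lambda>v. p [] * q (i # v)) + conv (\<lambda>v. p (i # v)) q"
      by (simp add: fun_eq_iff)
    then show ?case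
      by (simp add: conv_add_left conv_scale_left Cons.IH algebra_simps)
  qed (simp add: algebra_simps)
qed

lemma conv_nonzeroE:
  assumes "conv p q w \<noteq> 0"
  obtains u v where "w = u @ v" "p u \<noteq> 0" "q v \<noteq> 0"
  using assms
proof (induction w arbitrary: p thesis)
  case Nil
  then show ?case by force
next
  case (Cons i w)
  show ?case
  proof (cases "p [] * q (i # w) = 0")
    case True
    with Cons.prems(2) have "conv (\<lambda>v. p (i # v)) q w \<noteq> 0" by simp
    from Cons.IH[OF _ this] obtain u v where "w = u @ v" "p (i # u) \<noteq> 0" "q v \<noteq> 0" by blast
    then show ?thesis using Cons.prems(1)[of "i # u" v] by simp
  next
    case False
    then have "p [] \<noteq> 0" "q (i # w) \<noteq> 0" by auto
    then show ?thesis using Cons.prems(1)[of "[]" "i # w"] by simp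
  qed
qed

section \<open>Order of a series\<close>

definition vanishes_below :: "nat \<Rightarrow> ('a list \<Rightarrow> 'k::zero) \<Rightarrow> bool" where
  "vanishes_below n p \<longleftrightarrow> (\<forall>w. length w < n \<longrightarrow> p w = 0)"

lemma vanishes_below_mono: "vanishes_below n p \<Longrightarrow> m \<le> n \<Longrightarrow> vanishes_below m p"
  by (auto simp: vanishes_below_def)

lemma vanishes_below_zero [simp]: "vanishes_below n 0"
  by (simp add: vanishes_below_def)

lemma vanishes_below_add:
  fixes p q :: "'a list \<Rightarrow> 'k::comm_ring_1"
  shows "vanishes_below n p \<Longrightarrow> vanishes_below n q \<Longrightarrow> vanishes_below n (p + q)"
  by (simp add: vanishes_below_def)

lemma vanishes_below_diff:
  fixes p q :: "'a list \<Rightarrow> 'k::comm_ring_1"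
  shows "vanishes_below n p \<Longrightarrow> vanishes_below n q \<Longrightarrow> vanishes_below n (p - q)"
  by (simp add: vanishes_below_def)

lemma vanishes_below_conv:
  assumes "vanishes_below m p" "vanishes_below n q"
  shows "vanishes_below (m + n) (conv p q)"
  unfolding vanishes_below_def
proof (intro allI impI)
  fix w :: "'a list"
  assume less: "length w < m + n"
  show "conv p q w = 0"
  proof (rule ccontr)
    assume "conv p q w \<noteq> 0"
    then obtain u v where "w = u @ v" "p u \<noteq> 0" "q v \<noteq> 0" by (rule conv_nonzeroE)
    moreover from this assms have "length u \<ge> m" "length v \<ge> n"
      by (auto simp: vanishes_below_def not_less[symmetric])
    ultimately show False using less by simp
  qed
qed

section \<open>Multiplication by a letter and comparison of words\<close>

definition letter :: "'a \<Rightarrow> 'a list \<Rightarrow> 'k::comm_ring_1" where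
  "letter i w = (if w = [i] then 1 else 0)"

lemma conv_letter_left:
  fixes q :: "'a list \<Rightarrow> 'k::comm_ring_1"
  shows "conv (letter j) q w = (if w \<noteq> [] \<and> hd w = j then q (tl w) else 0)"
proof (cases w)
  case (Cons i v)
  \<comment> \<open>A letter shifted by one place is zero or the unit series, the indicator of the
    empty word.\<close>
  have "(\<lambda>v. letter j (i # v)) = (\<lambda>v. (if i = j then 1 else 0) * (if v = [] then 1 else 0 :: 'k))"
    by (auto simp: letter_def fun_eq_iff)
  moreover have "conv (\<lambda>v. if v = [] then 1 else 0) q v = q v" for v
  proof (cases v)
    case (Cons a list)
    have "conv (\<lambda>v. 0) q list = 0"
      using conv_zero_left[of q] by (simp add: zero_fun_def)
    then show ?thesis by (simp add: Cons)
  qed simp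
  ultimately show ?thesis by (simp add: Cons conv_scale_left letter_def)
qed (simp add: letter_def)

lemma conv_letter_right:
  "conv p (letter j) w = (if w \<noteq> [] \<and> last w = j then p (butlast w) else 0)"
proof (induction w arbitrary: p)
  case (Cons i w)
  then show ?case by (auto simp: letter_def)
qed (simp add: letter_def)

text \<open>The form in which \<open>g \<ge> 3\<close> enters the word comparisons.\<close>

lemma obtain_index_avoiding:
  fixes g i k :: nat
  assumes "g \<ge> 3"
  obtains j where "j < g" "j \<noteq> i" "j \<noteq> k"
proof -
  have "\<not> {..<g} \<subseteq> {i, k}"
    using card_mono[of "{i, k}" "{..<g}"] assms card_insert_le_m1[of 2 "{k}" i] by fastforce
  then show ?thesis using that by blast
qed

text \<open>
  Comparing the coefficients of a word of length \<open>n + 1\<close> that starts with \<open>j\<close> and does not end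
  with \<open>i\<close> or \<open>j\<close> (or the other way round) shows that \<open>b i\<close> is supported on words that start and
  end with \<open>i\<close>; a third letter then rules these out as well.
\<close>

lemma commutator_system_trivial:
  fixes b :: "nat \<Rightarrow> nat list \<Rightarrow> 'k::field_char_0"
  assumes g: "g \<ge> 3" and n: "n \<ge> 1"
    and low: "\<And>i. i < g \<Longrightarrow> vanishes_below n (b i)"
    and eq: "\<And>i j. \<lbrakk>i < g; j < g\<rbrakk> \<Longrightarrow> vanishes_below (n + 2)
        ((conv (b i) (letter j) - conv (letter j) (b i))
          - (conv (b j) (letter i) - conv (letter i) (b j)))"
    and i: "i < g"
  shows "vanishes_below (n + 1) (b i)"
proof -
  \<comment> \<open>The coefficient of a word of length \<open>n + 1\<close> in \<open>eq\<close>: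
    order \<open>n + 2\<close> makes it zero, and multiplication by a letter strips the last or
    first letter of the word, leaving words of length \<open>n\<close>.\<close>
  have E: "(if last w = j then b i (butlast w) else 0) - (if hd w = j then b i (tl w) else 0)
         = (if last w = i then b j (butlast w) else 0) - (if hd w = i then b j (tl w) else 0)"
    if "i < g" "j < g" "length w = n + 1" for i j w
  proof -
    from that(3) have "w \<noteq> []" "length w < n + 2" by auto
    then have "(conv (b i) (letter j) w - conv (letter j) (b i) w)
        - (conv (b j) (letter i) w - conv (letter i) (b j) w) = 0"
      using eq[OF that(1,2)] by (simp add: vanishes_below_def)
    with \<open>w \<noteq> []\<close> show ?thesis by (simp add: conv_letter_left conv_letter_right)
  qed
  have last0: "b i (v @ [k]) = 0" if "i < g" "k \<noteq> i" "length v + 1 = n" for i v k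
  proof -
    obtain j where j: "j < g" "j \<noteq> i" "j \<noteq> k" using g by (rule obtain_index_avoiding)
    show ?thesis using E[of i j "j # v @ [k]"] that j by auto
  qed
  have hd0: "b i (k # v) = 0" if "i < g" "k \<noteq> i" "length v + 1 = n" for i v k
  proof -
    obtain j where j: "j < g" "j \<noteq> i" "j \<noteq> k" using g by (rule obtain_index_avoiding)
    show ?thesis using E[of i j "k # v @ [j]"] that j by (auto simp: butlast_append)
  qed
  have "b i w = 0" if w: "length w = n" for w
  proof (cases "n = 1")
    case True
    \<comment> \<open>In degree one the last and first letters coincide, and the word
      \<open>[j, i]\<close> only shows that diagonal coefficients are pairwise opposite. Going round
      three different letters makes \<open>b i [i]\<close> equal to its own negative, hence zero in
      characteristic zero.\<close>
    have single: "b i [i] = - b j [j]" if "i < g" "j < g" "i \<noteq> j" for i j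
    proof -
      have "- b i [i] = b j [j]" using E[of i j "[j, i]"] that True by simp
      then show ?thesis by (metis minus_minus)
    qed
    show ?thesis
    proof (cases "w = [i]")
      case True
      obtain j where j: "j < g" "j \<noteq> i" using obtain_index_avoiding[OF g, of i i] by metis
      obtain k where k: "k < g" "k \<noteq> i" "k \<noteq> j" using g by (rule obtain_index_avoiding)
      have "b i [i] = - b i [i]"
        using single[of i j] single[of j k] single[of k i] i j k by auto
      then show ?thesis using True by (simp add: eq_neg_iff_add_eq_0 flip: mult_2)
    next
      case False
      with w \<open>n = 1\<close> obtain k where "w = [k]" "k \<noteq> i" by (auto simp: length_Suc_conv)
      then show ?thesis using hd0[of i k "[]"] i \<open>n = 1\<close> by simp
    qed
  next
    case False
    with n w obtain v l k where w': "w = v @ [k, l]"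
      by (metis One_nat_def append_butlast_last_id append.assoc append_Cons append_Nil
          butlast.simps(1) length_butlast length_greater_0_conv list.size(3) nat_neq_iff
          diff_is_0_eq not_le le_antisym)
    show ?thesis
    proof (cases "l = i")
      case True
      \<comment> \<open>In the word \<open>j # w\<close> with \<open>w\<close> ending in
        \<open>k\<close>, \<open>i\<close>, the coefficient \<open>b i w\<close> is balanced by
        \<open>b j\<close> at a word ending in \<open>k\<close>. As \<open>j \<noteq> k\<close>, the
        latter is zero by \<open>last0\<close>.\<close>
      obtain j where j: "j < g" "j \<noteq> i" "j \<noteq> k" using g by (rule obtain_index_avoiding)
      have "b j (j # v @ [k]) = 0"
        using last0[of j k "j # v"] j w w' by auto
      then show ?thesis
        using E[of i j "j # w"] i j w w' True by (auto simp: butlast_append)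
    next
      case False
      then show ?thesis using last0[of i l "v @ [k]"] i w w' by auto
    qed
  qed
  with low[OF i] show ?thesis
    by (auto simp: vanishes_below_def less_Suc_eq)
qed

section \<open>The series of an element of the free Lie algebra\<close>

definition single :: "'k::zero \<Rightarrow> 'a \<Rightarrow> 'a \<Rightarrow> 'k" where
  "single c t = (\<lambda>s. if s = t then c else 0)"

definition scale :: "'k::times \<Rightarrow> ('a \<Rightarrow> 'k) \<Rightarrow> 'a \<Rightarrow> 'k" where
  "scale c f = (\<lambda>t. c * f t)"

lemma scale_apply: "scale c f t = c * f t"
  by (simp add: scale_def)

lemma vanishes_below_scale:
  fixes p :: "'a list \<Rightarrow> 'k::comm_ring_1"
  shows "vanishes_below n p \<Longrightarrow> vanishes_below n (scale a p)"
  by (simp add: vanishes_below_def scale_def)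

text \<open>Adding one basis element at a time. The premise \<open>f t \<noteq> 0\<close> of the
  step keeps every added element in the support of the original \<open>f\<close>, so that knowledge
  about this support survives the induction.\<close>

lemma finite_support_induct [consumes 1, case_names zero add]:
  fixes f :: "'a \<Rightarrow> 'k::comm_ring_1"
  assumes "finite {t. f t \<noteq> 0}"
    and "Q 0"
    and "\<And>h c t. \<lbrakk>f t \<noteq> 0; finite {t. h t \<noteq> 0}; \<And>s. h s \<noteq> 0 \<Longrightarrow> f s \<noteq> 0; Q h\<rbrakk> \<Longrightarrow> Q (h + single c t)"
  shows "Q f"
proof -
  have "Q h" if "finite B" "B \<subseteq> {t. f t \<noteq> 0}" "\<And>s. h s \<noteq> 0 \<Longrightarrow> s \<in> B" for B h
    using that
  proof (induction B arbitrary: h rule: finite_induct)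
    case empty
    then have "h = 0" by (auto simp: fun_eq_iff)
    with assms(2) show ?case by (simp only:)
  next
    case (insert x B)
    define h' where "h' = h(x := 0)"
    have B: "s \<in> B" if "h' s \<noteq> 0" for s
      using that insert.prems(2)[of s] by (auto simp: h'_def split: if_splits)
    then have "Q h'" using insert by simp
    moreover have "finite {t. h' t \<noteq> 0}" by (rule finite_subset[OF _ insert.hyps(1)]) (use B in auto)
    ultimately have "Q (h' + single (h x) x)"
      using insert.prems(1) B by (intro assms(3)) auto
    moreover have "h' + single (h x) x = h" by (auto simp: h'_def single_def fun_eq_iff)
    ultimately show ?case by simp
  qed
  from this[of "{t. f t \<noteq> 0}" f] assms(1) show ?thesis by simp
qed

text \<open>The product of \<open>free_nonassoc\<close>, detached from the record and from the
  number of generators. With pointwise addition on functions, ordinary simplification for abelian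
  groups then applies.\<close>

definition magma_prod :: "('x magma \<Rightarrow> 'k::comm_ring_1) \<Rightarrow> ('x magma \<Rightarrow> 'k) \<Rightarrow> 'x magma \<Rightarrow> 'k" where
  "magma_prod f h = (\<lambda>t. case t of Gen _ \<Rightarrow> 0 | Node s u \<Rightarrow> f s * h u)"

lemma magma_prod_simps [simp]:
  "magma_prod f h (Gen i) = 0" "magma_prod f h (Node s t) = f s * h t"
  by (simp_all add: magma_prod_def)

lemma magma_prod_linear:
  "magma_prod (f + f') h = magma_prod f h + magma_prod f' h"
  "magma_prod f (h + h') = magma_prod f h + magma_prod f h'"
  "magma_prod (f - f') h = magma_prod f h - magma_prod f' h"
  "magma_prod f (h - h') = magma_prod f h - magma_prod f h'"
  "magma_prod (scale c f) h = scale c (magma_prod f h)"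
  "magma_prod f (scale c h) = scale c (magma_prod f h)"
  "magma_prod 0 h = 0" "magma_prod f 0 = 0"
  by (auto simp: magma_prod_def scale_def fun_eq_iff algebra_simps split: magma.splits)

lemma magma_prod_single: "magma_prod (single c s) (single d t) = single (c * d) (Node s t)"
  by (auto simp: magma_prod_def single_def fun_eq_iff split: magma.splits)

lemma free_nonassoc_ops:
  fixes f h :: "nat magma \<Rightarrow> 'k::field"
  shows "f \<oplus>\<^bsub>free_nonassoc g\<^esub> h = f + h"
    and "\<zero>\<^bsub>free_nonassoc g\<^esub> = (0 :: nat magma \<Rightarrow> 'k)"
    and "f \<otimes>\<^bsub>free_nonassoc g\<^esub> h = magma_prod f h"
    and "c \<odot>\<^bsub>free_nonassoc g\<^esub> f = scale c f"
  by (simp_all add: free_nonassoc_def magma_prod_def scale_def fun_eq_iff)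

lemma free_nonassoc_carrier:
  "f \<in> carrier (free_nonassoc g) \<longleftrightarrow>
     finite {t. f t \<noteq> 0} \<and> (\<forall>t. f t \<noteq> 0 \<longrightarrow> leaves t \<subseteq> {..<g})"
  by (simp add: free_nonassoc_def)

lemma free_nonassoc_closed:
  fixes f h :: "nat magma \<Rightarrow> 'k::field"
  assumes "f \<in> carrier (free_nonassoc g)"
  shows "h \<in> carrier (free_nonassoc g) \<Longrightarrow> f + h \<in> carrier (free_nonassoc g)"
    and "h \<in> carrier (free_nonassoc g) \<Longrightarrow> magma_prod f h \<in> carrier (free_nonassoc g)"
    and "scale c f \<in> carrier (free_nonassoc g)"
    and "h \<in> carrier (free_nonassoc g) \<Longrightarrow> f - h \<in> carrier (free_nonassoc g)"
proof -
  interpret A: nonassoc_algebra "free_nonassoc g :: ('k, nat magma \<Rightarrow> 'k) module"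
    by (rule nonassoc_algebra_free_nonassoc)
  show add: "f + h \<in> carrier (free_nonassoc g)" if "h \<in> carrier (free_nonassoc g)"
    for h :: "nat magma \<Rightarrow> 'k"
    using A.add.m_closed[OF assms that] by (simp add: free_nonassoc_ops)
  show "magma_prod f h \<in> carrier (free_nonassoc g)" if "h \<in> carrier (free_nonassoc g)"
    using A.mult_closed[OF assms that] by (simp add: free_nonassoc_ops)
  have scale: "scale c h \<in> carrier (free_nonassoc g)" if "h \<in> carrier (free_nonassoc g)"
    for c and h :: "nat magma \<Rightarrow> 'k"
    using A.smult_closed[OF _ that, of c] by (simp add: free_nonassoc_ops)
  show "scale c f \<in> carrier (free_nonassoc g)" by (rule scale[OF assms])
  have "f - h = f + scale (-1) h" by (simp add: scale_def fun_eq_iff)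
  then show "f - h \<in> carrier (free_nonassoc g)" if "h \<in> carrier (free_nonassoc g)"
    using add[OF scale[OF that]] by (simp only:)
qed

lemma free_nonassoc_zero [simp]: "0 \<in> carrier (free_nonassoc g)"
  by (simp add: free_nonassoc_carrier)

lemma free_nonassoc_single [simp]:
  "leaves t \<subseteq> {..<g} \<Longrightarrow> single c t \<in> carrier (free_nonassoc g)"
  by (auto simp: free_nonassoc_carrier single_def)

lemma free_nonassoc_induct [consumes 1, case_names zero add]:
  assumes "f \<in> carrier (free_nonassoc g)"
    and "Q 0"
    and "\<And>h c t. \<lbrakk>f t \<noteq> 0; leaves t \<subseteq> {..<g}; h \<in> carrier (free_nonassoc g); Q h\<rbrakk> \<Longrightarrow> Q (h + single c t)"
  shows "Q f"
proof -
  have fin: "finite {t. f t \<noteq> 0}" and leaves: "\<And>t. f t \<noteq> 0 \<Longrightarrow> leaves t \<subseteq> {..<g}"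
    using assms(1) by (auto simp: free_nonassoc_carrier)
  from fin show ?thesis
  proof (induction rule: finite_support_induct)
    case (add h c t)
    then show ?case using leaves by (intro assms(3)) (auto simp: free_nonassoc_carrier)
  qed (rule assms(2))
qed

section \<open>Associative expansion of bracketings\<close>

fun leaf_count :: "'x magma \<Rightarrow> nat" where
  "leaf_count (Gen i) = 1"
| "leaf_count (Node s t) = leaf_count s + leaf_count t"

lemma leaf_count_nonzero [simp]: "leaf_count t \<noteq> 0"
  by (induction t) auto

text \<open>The tree is evaluated in the free associative algebra with the commutator as its
  product.\<close>

fun lie_poly :: "'x magma \<Rightarrow> 'x list \<Rightarrow> 'k::comm_ring_1" where
  "lie_poly (Gen i) = letter i"
| "lie_poly (Node s t) = conv (lie_poly s) (lie_poly t) - conv (lie_poly t) (lie_poly s)"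

lemma lie_poly_homogeneous:
  "lie_poly t w \<noteq> (0 :: 'k::comm_ring_1) \<Longrightarrow> length w = leaf_count t"
proof (induction t arbitrary: w)
  case (Gen i)
  then show ?case by (simp add: letter_def split: if_splits)
next
  case (Node s t)
  then have "conv (lie_poly s) (lie_poly t) w \<noteq> (0 :: 'k) \<or> conv (lie_poly t) (lie_poly s) w \<noteq> (0 :: 'k)"
    by auto
  then show ?case
    by (elim disjE conv_nonzeroE) (use Node.IH in auto)
qed

text \<open>The linear extension of \<open>lie_poly\<close>. A sum over an infinite support would
  have the default value 0, so additivity is stated for finite supports.\<close>

definition lie_series :: "('x magma \<Rightarrow> 'k::comm_ring_1) \<Rightarrow> 'x list \<Rightarrow> 'k" where
  "lie_series f = (\<lambda>w. \<Sum>t | f t \<noteq> 0. f t * lie_poly t w)"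

lemma lie_series_eq_sum:
  assumes "finite S" "{t. f t \<noteq> 0} \<subseteq> S"
  shows "lie_series f w = (\<Sum>t\<in>S. f t * lie_poly t w)"
  unfolding lie_series_def by (rule sum.mono_neutral_left) (use assms in auto)

lemma lie_series_add:
  assumes "finite {t. f t \<noteq> 0}" "finite {t. h t \<noteq> 0}"
  shows "lie_series (f + h) = lie_series f + lie_series h"
proof
  fix w
  let ?S = "{t. f t \<noteq> 0} \<union> {t. h t \<noteq> 0}"
  show "lie_series (f + h) w = (lie_series f + lie_series h) w"
    using assms
    by (subst plus_fun_apply, subst (1 2 3) lie_series_eq_sum[of ?S])
      (auto simp: algebra_simps sum.distrib)
qed

lemma lie_series_scale:
  fixes f :: "'x magma \<Rightarrow> 'k::idom"
  shows "lie_series (scale c f) = scale c (lie_series f)"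
  by (cases "c = 0") (auto simp: lie_series_def scale_def sum_distrib_left mult.assoc fun_eq_iff)

lemma lie_series_zero [simp]: "lie_series 0 = 0"
  by (simp add: lie_series_def fun_eq_iff)

lemma lie_series_single: "lie_series (single c t) = scale c (lie_poly t)"
proof
  show "lie_series (single c t) w = scale c (lie_poly t) w" for w
    by (subst lie_series_eq_sum[of "{t}"]) (auto simp: single_def scale_def)
qed

lemma scale_algebra:
  fixes c :: "'k::comm_ring_1"
  shows "scale c (f + h) = scale c f + scale c h" "scale c (f - h) = scale c f - scale c h"
    "scale c (scale d f) = scale (c * d) f" "scale 0 f = 0" "scale c 0 = 0" "scale 1 f = f"
  by (simp_all add: scale_def fun_eq_iff algebra_simps)

lemma lie_series_diff:
  fixes f h :: "'x magma \<Rightarrow> 'k::idom"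
  assumes "finite {t. f t \<noteq> 0}" "finite {t. h t \<noteq> 0}"
  shows "lie_series (f - h) = lie_series f - lie_series h"
proof -
  have "f - h = f + scale (-1) h" by (simp add: scale_def fun_eq_iff)
  moreover have "finite {t. scale (-1) h t \<noteq> 0}" using assms(2) by (simp add: scale_def)
  ultimately have "lie_series (f - h) = lie_series f + scale (-1) (lie_series h)"
    using lie_series_add[OF assms(1)] by (simp only: lie_series_scale)
  then show ?thesis by (simp add: fun_eq_iff scale_def)
qed

lemma conv_scale:
  "conv (scale c p) q = scale c (conv p q)" "conv p (scale c q) = scale c (conv p q)"
  by (simp_all add: scale_def conv_scale_left conv_scale_right)

lemma lie_series_magma_prod:
  fixes f h :: "nat magma \<Rightarrow> 'k::field"
  assumes "f \<in> carrier (free_nonassoc g)" "h \<in> carrier (free_nonassoc g)"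
  shows "lie_series (magma_prod f h) =
    conv (lie_series f) (lie_series h) - conv (lie_series h) (lie_series f)"
proof -
  have series_add: "lie_series (f + h) = lie_series f + lie_series h"
    if "f \<in> carrier (free_nonassoc g)" "h \<in> carrier (free_nonassoc g)" for f h :: "nat magma \<Rightarrow> 'k"
    using that by (intro lie_series_add) (auto simp: free_nonassoc_carrier)
  \<comment> \<open>Both sides are bilinear, so two nested inductions reduce the claim to a pair of
    trees. The inner one runs over \<open>h\<close> with a single tree on the left.\<close>
  have single: "lie_series (magma_prod (single c s) h) =
      conv (lie_series (single c s)) (lie_series h) - conv (lie_series h) (lie_series (single c s))"
    if s: "leaves s \<subseteq> {..<g}" for c s
    using assms(2)
  proof (induction rule: free_nonassoc_induct)
    case zero
    show ?case by (simp only: magma_prod_linear lie_series_zero conv_zero_left conv_zero_right diff_0_right)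
  next
    case (add h d t)
    have "lie_series (magma_prod (single c s) (h + single d t)) =
        lie_series (magma_prod (single c s) h) + lie_series (magma_prod (single c s) (single d t))"
      using s add(2,3) by (simp only: magma_prod_linear series_add free_nonassoc_closed free_nonassoc_single)
    also have "lie_series (magma_prod (single c s) (single d t)) =
        conv (lie_series (single c s)) (lie_series (single d t))
          - conv (lie_series (single d t)) (lie_series (single c s))"
      by (simp add: magma_prod_single lie_series_single conv_scale scale_algebra mult.commute)
    finally show ?case
      using add by (simp only: series_add free_nonassoc_single conv_add_left conv_add_right)
          (simp add: fun_eq_iff algebra_simps)
  qed
  from assms(1) show ?thesis
  proof (induction rule: free_nonassoc_induct)
    case zero
    show ?case by (simp only: magma_prod_linear lie_series_zero conv_zero_left conv_zero_right diff_0_right)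
  next
    case (add f c t)
    have "lie_series (magma_prod (f + single c t) h) =
        lie_series (magma_prod f h) + lie_series (magma_prod (single c t) h)"
      using assms(2) add(2,3) by (simp only: magma_prod_linear series_add free_nonassoc_closed free_nonassoc_single)
    then show ?case
      using add by (simp only: series_add single free_nonassoc_single conv_add_left conv_add_right)
          (simp add: fun_eq_iff algebra_simps)
  qed
qed

section \<open>The ideal of Lie relations\<close>

abbreviation lie_ideal :: "nat \<Rightarrow> (nat magma \<Rightarrow> 'k::field) set" where
  "lie_ideal g \<equiv> generated_ideal (free_nonassoc g) (lie_relators (free_nonassoc g))"

lemma algebra_ideal_lie_ideal:
  "algebra_ideal (lie_ideal g) (free_nonassoc g :: ('k::field, nat magma \<Rightarrow> 'k) module)"
    and lie_relators_subset:
  "lie_relators (free_nonassoc g) \<subseteq> (lie_ideal g :: (nat magma \<Rightarrow> 'k) set)"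
proof -
  interpret A: nonassoc_algebra "free_nonassoc g :: ('k, nat magma \<Rightarrow> 'k) module"
    by (rule nonassoc_algebra_free_nonassoc)
  have rel: "lie_relators (free_nonassoc g) \<subseteq> carrier (free_nonassoc g :: ('k, nat magma \<Rightarrow> 'k) module)"
    by (auto simp: lie_relators_def A.mult_closed)
  show "algebra_ideal (lie_ideal g) (free_nonassoc g :: ('k, nat magma \<Rightarrow> 'k) module)"
    "lie_relators (free_nonassoc g) \<subseteq> (lie_ideal g :: (nat magma \<Rightarrow> 'k) set)"
    by (rule A.generated_ideal[OF rel])+
qed

lemma lie_ideal_closed:
  fixes f h :: "nat magma \<Rightarrow> 'k::field"
  shows "f \<in> lie_ideal g \<Longrightarrow> f \<in> carrier (free_nonassoc g)"
    and "0 \<in> (lie_ideal g :: (nat magma \<Rightarrow> 'k) set)"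
    and "\<lbrakk>f \<in> lie_ideal g; h \<in> lie_ideal g\<rbrakk> \<Longrightarrow> f + h \<in> lie_ideal g"
    and "\<lbrakk>f \<in> lie_ideal g; h \<in> lie_ideal g\<rbrakk> \<Longrightarrow> f - h \<in> lie_ideal g"
    and "f \<in> lie_ideal g \<Longrightarrow> scale c f \<in> lie_ideal g"
    and "\<lbrakk>f \<in> carrier (free_nonassoc g); h \<in> lie_ideal g\<rbrakk> \<Longrightarrow> magma_prod f h \<in> lie_ideal g"
proof -
  interpret A: nonassoc_algebra "free_nonassoc g :: ('k, nat magma \<Rightarrow> 'k) module"
    by (rule nonassoc_algebra_free_nonassoc)
  have sub: "submodule (lie_ideal g) (ring_of_type_algebra :: 'k ring)
      (free_nonassoc g :: ('k, nat magma \<Rightarrow> 'k) module)"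
    using algebra_ideal_lie_ideal by (auto simp: algebra_ideal_def)
  note E = A.submoduleE[OF sub]
  show carr: "f \<in> lie_ideal g \<Longrightarrow> f \<in> carrier (free_nonassoc g)" for f :: "nat magma \<Rightarrow> 'k"
    using E(1) by blast
  show add: "f + h \<in> lie_ideal g" if "f \<in> lie_ideal g" "h \<in> lie_ideal g" for f h :: "nat magma \<Rightarrow> 'k"
    using E(5)[OF that] by (simp add: free_nonassoc_ops)
  show scale: "scale c f \<in> lie_ideal g" if "f \<in> lie_ideal g" for c and f :: "nat magma \<Rightarrow> 'k"
    using E(4)[OF _ that, of c] by (simp add: free_nonassoc_ops)
  have "f - h = f + scale (-1) h" by (simp add: scale_def fun_eq_iff)
  then show "f - h \<in> lie_ideal g" if "f \<in> lie_ideal g" "h \<in> lie_ideal g"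
    using add[OF that(1) scale[OF that(2)]] by (simp only:)
  show "(0 :: nat magma \<Rightarrow> 'k) \<in> lie_ideal g"
  proof -
    obtain x where "x \<in> (lie_ideal g :: (nat magma \<Rightarrow> 'k) set)" using E(2) by blast
    from scale[OF this, of 0] show ?thesis by (simp add: scale_algebra)
  qed
  show "magma_prod f h \<in> lie_ideal g" if "f \<in> carrier (free_nonassoc g)" "h \<in> lie_ideal g"
    using algebra_ideal_lie_ideal[of g, where 'k='k] that
    by (auto simp: algebra_ideal_def free_nonassoc_ops)
qed

lemma lie_ideal_alternating:
  assumes "f \<in> carrier (free_nonassoc g)"
  shows "magma_prod f f \<in> lie_ideal g"
  using lie_relators_subset[of g] assms by (auto simp: lie_relators_def free_nonassoc_ops)

lemma lie_ideal_anticommutative: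
  assumes "f \<in> carrier (free_nonassoc g)" "h \<in> carrier (free_nonassoc g)"
  shows "magma_prod f h + magma_prod h f \<in> lie_ideal g"
proof -
  \<comment> \<open>Polarization of the alternating relator at \<open>f + h\<close>.\<close>
  have "magma_prod f h + magma_prod h f =
      magma_prod (f + h) (f + h) - magma_prod f f - magma_prod h h"
    by (simp add: magma_prod_linear)
  also have "\<dots> \<in> lie_ideal g"
    using assms by (intro lie_ideal_closed(4) lie_ideal_alternating free_nonassoc_closed(1))
  finally show ?thesis .
qed

lemma lie_ideal_jacobi:
  assumes "f \<in> carrier (free_nonassoc g)" "h \<in> carrier (free_nonassoc g)" "k \<in> carrier (free_nonassoc g)"
  shows "magma_prod f (magma_prod h k) + magma_prod h (magma_prod k f) + magma_prod k (magma_prod f h)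
    \<in> lie_ideal g"
proof -
  have "f \<otimes>\<^bsub>free_nonassoc g\<^esub> (h \<otimes>\<^bsub>free_nonassoc g\<^esub> k) \<oplus>\<^bsub>free_nonassoc g\<^esub>
      h \<otimes>\<^bsub>free_nonassoc g\<^esub> (k \<otimes>\<^bsub>free_nonassoc g\<^esub> f) \<oplus>\<^bsub>free_nonassoc g\<^esub>
      k \<otimes>\<^bsub>free_nonassoc g\<^esub> (f \<otimes>\<^bsub>free_nonassoc g\<^esub> h) \<in> lie_relators (free_nonassoc g)"
    using assms unfolding lie_relators_def by blast
  then show ?thesis using lie_relators_subset[of g] by (auto simp: free_nonassoc_ops)
qed

text \<open>Commutators in an associative algebra alternate and satisfy the Jacobi identity, so the
  elements with zero series form an ideal that contains all relators. Thus the series depends only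
  on the class in the free Lie algebra.\<close>

lemma lie_series_lie_ideal:
  fixes f :: "nat magma \<Rightarrow> 'k::field"
  assumes "f \<in> lie_ideal g"
  shows "lie_series f = 0"
proof -
  interpret A: nonassoc_algebra "free_nonassoc g :: ('k, nat magma \<Rightarrow> 'k) module"
    by (rule nonassoc_algebra_free_nonassoc)
  let ?K = "{f \<in> carrier (free_nonassoc g). lie_series f = (0 :: nat list \<Rightarrow> 'k)}"
  have series_add: "lie_series (f + h) = lie_series f + lie_series h"
    if "f \<in> carrier (free_nonassoc g)" "h \<in> carrier (free_nonassoc g)" for f h :: "nat magma \<Rightarrow> 'k"
    using that by (intro lie_series_add) (auto simp: free_nonassoc_carrier)
  have "submodule ?K (ring_of_type_algebra :: 'k ring) (free_nonassoc g)"
  proof (rule A.submoduleI)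
    show "\<ominus>\<^bsub>free_nonassoc g\<^esub> f \<in> ?K" if f: "f \<in> ?K" for f
    proof -
      have "\<ominus>\<^bsub>free_nonassoc g\<^esub> f = scale (-1) f"
      proof (rule A.add.inv_equality)
        show "scale (-1) f \<oplus>\<^bsub>free_nonassoc g\<^esub> f = \<zero>\<^bsub>free_nonassoc g\<^esub>"
          by (simp add: free_nonassoc_ops scale_def fun_eq_iff)
      qed (use f in \<open>auto intro: free_nonassoc_closed\<close>)
      then show ?thesis using f by (auto simp: lie_series_scale scale_algebra intro: free_nonassoc_closed)
    qed
  qed (auto simp: free_nonassoc_ops free_nonassoc_closed series_add
      lie_series_scale scale_algebra)
  then have "algebra_ideal ?K (free_nonassoc g)"
    by (auto simp: algebra_ideal_def free_nonassoc_ops free_nonassoc_closed lie_series_magma_prod)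
  moreover have "lie_relators (free_nonassoc g) \<subseteq> ?K"
    by (auto simp: lie_relators_def free_nonassoc_ops free_nonassoc_closed series_add
        lie_series_magma_prod[of _ g] conv_diff_left conv_diff_right conv_assoc)
  ultimately have "lie_ideal g \<subseteq> ?K" unfolding generated_ideal_def by blast
  with assms show ?thesis by blast
qed

section \<open>The Dynkin map\<close>

text \<open>
  A word acts on the free nonassociative algebra by iterated left multiplication with generators;
  \<open>theta\<close> extends this linearly to series. Read off coefficientwise, the infinite sum over words
  becomes a recursion on the argument tree.
\<close>

fun theta :: "('x list \<Rightarrow> 'k::comm_ring_1) \<Rightarrow> ('x magma \<Rightarrow> 'k) \<Rightarrow> 'x magma \<Rightarrow> 'k" where
  "theta p u (Gen j) = p [] * u (Gen j)"
| "theta p u (Node (Gen i) t) = p [] * u (Node (Gen i) t) + theta (\<lambda>w. p (i # w)) u t"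
| "theta p u (Node (Node r s) t) = p [] * u (Node (Node r s) t)"

lemma theta_linear_left:
  "theta (p + q) u = theta p u + theta q u"
  "theta (scale c p) u = scale c (theta p u)"
proof -
  have "theta (p + q) u t = theta p u t + theta q u t" for t
  proof (induction p u t arbitrary: q rule: theta.induct)
    case (2 p u i t)
    from "2.IH"[of "\<lambda>w. q (i # w)"] show ?case by (simp add: plus_fun_def algebra_simps)
  qed (simp_all add: algebra_simps)
  then show "theta (p + q) u = theta p u + theta q u" by (simp add: fun_eq_iff)
  have "theta (scale c p) u t = c * theta p u t" for t
    by (induction p u t rule: theta.induct) (auto simp: scale_def algebra_simps)
  then show "theta (scale c p) u = scale c (theta p u)" by (simp add: fun_eq_iff scale_def)
qed

lemma theta_diff_left: "theta (p - q) u = theta p u - theta q u"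
  using theta_linear_left(1)[of "p - q" q u] by simp

lemma theta_linear_right:
  "theta p (u + v) = theta p u + theta p v"
  "theta p (scale c u) = scale c (theta p u)"
proof -
  have "theta p (u + v) t = theta p u t + theta p v t" for t
    by (induction p u t rule: theta.induct) (auto simp: algebra_simps)
  then show "theta p (u + v) = theta p u + theta p v" by (simp add: fun_eq_iff)
  have "theta p (scale c u) t = c * theta p u t" for t
    by (induction p u t rule: theta.induct) (auto simp: scale_def algebra_simps)
  then show "theta p (scale c u) = scale c (theta p u)" by (simp add: fun_eq_iff scale_def)
qed

lemma theta_diff_right: "theta p (u - v) = theta p u - theta p v"
  using theta_linear_right(1)[of p "u - v" v] by simp

lemma conv_Cons: "(\<lambda>w. conv p q (i # w)) = scale (p []) (\<lambda>w. q (i # w)) + conv (\<lambda>w. p (i # w)) q"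
  by (simp add: fun_eq_iff scale_def)

text \<open>Concatenation of words becomes composition of iterated left multiplications:
  \<open>theta\<close> is a left action of the algebra of series.\<close>

lemma theta_conv: "theta (conv p q) u = theta p (theta q u)"
proof
  show "theta (conv p q) u t = theta p (theta q u) t" for t
    by (induction p u t rule: theta.induct)
      (simp_all add: conv_Cons theta_linear_left scale_apply algebra_simps del: conv.simps(2))
qed

lemma theta_letter:
  fixes u :: "'a magma \<Rightarrow> 'b::comm_ring_1"
  shows "theta (letter i) u = magma_prod (single 1 (Gen i)) u"
proof
  fix t
  have zero: "theta (\<lambda>_. 0) u t = 0" for t
    using theta_linear_left(2)[of 0 0 u] by (simp add: scale_def fun_eq_iff)
  have unit: "theta (\<lambda>w :: 'a list. if w = [] then 1 else 0) u t = u t" for t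
    by (cases "(\<lambda>w :: 'a list. if w = [] then 1 else 0 :: 'b, u, t)" rule: theta.cases) (auto simp: zero)
  have "(\<lambda>w. letter i (j # w)) = (if i = j then (\<lambda>w :: 'a list. if w = [] then 1 else 0 :: 'b) else (\<lambda>_. 0))" for j
    by (auto simp: letter_def fun_eq_iff)
  then show "theta (letter i) u t = magma_prod (single 1 (Gen i)) u t"
    by (cases "(letter i :: 'a list \<Rightarrow> 'b, u, t)" rule: theta.cases)
      (auto simp: zero unit single_def letter_def)
qed

text \<open>
  The Dynkin map sends a word \<open>i\<^sub>1 \<dots> i\<^sub>n\<close> to \<open>i\<^sub>1 (i\<^sub>2 (\<dots> i\<^sub>n))\<close> and the empty word to zero.
\<close>

fun dynkin :: "('x list \<Rightarrow> 'k::comm_ring_1) \<Rightarrow> 'x magma \<Rightarrow> 'k" where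
  "dynkin p (Gen j) = p [j]"
| "dynkin p (Node (Gen i) t) = dynkin (\<lambda>w. p (i # w)) t"
| "dynkin p (Node (Node r s) t) = 0"

lemma dynkin_linear:
  "dynkin (p + q) = dynkin p + dynkin q"
  "dynkin (scale c p) = scale c (dynkin p)"
proof -
  have "dynkin (p + q) t = dynkin p t + dynkin q t" for t
    by (induction p t arbitrary: q rule: dynkin.induct) (auto simp: plus_fun_def)
  then show "dynkin (p + q) = dynkin p + dynkin q" by (simp add: fun_eq_iff)
  have "dynkin (scale c p) t = c * dynkin p t" for t
    by (induction p t rule: dynkin.induct) (auto simp: scale_def)
  then show "dynkin (scale c p) = scale c (dynkin p)" by (simp add: fun_eq_iff scale_def)
qed

lemma dynkin_diff: "dynkin (p - q) = dynkin p - dynkin q"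
  using dynkin_linear(1)[of "p - q" q] by simp

lemma dynkin_zero [simp]: "dynkin 0 = 0"
  using dynkin_linear(2)[of 0 0] by (simp add: scale_algebra)

text \<open>For nonempty \<open>v\<close>, the Dynkin image of \<open>u @ v\<close> is the action of
  \<open>u\<close> on the Dynkin image of \<open>v\<close>. The condition on \<open>q\<close>
  excludes the empty \<open>v\<close>, where the left side need not vanish but the right side
  does.\<close>

lemma dynkin_conv:
  assumes "q [] = 0"
  shows "dynkin (conv p q) = theta p (dynkin q)"
proof
  show "dynkin (conv p q) t = theta p (dynkin q) t" for t
    by (induction p "dynkin q" t rule: theta.induct, simp add: assms)
      (simp_all add: assms conv_Cons dynkin_linear scale_apply del: conv.simps(2))
qed

lemma dynkin_letter:
  "dynkin (letter i :: 'a list \<Rightarrow> 'b::comm_ring_1) = single 1 (Gen i)"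
proof
  fix t :: "'a magma"
  have "(\<lambda>w. letter i (j # w)) = (if i = j then (\<lambda>w :: 'a list. if w = [] then 1 else 0 :: 'b) else 0)" for j
    by (auto simp: letter_def fun_eq_iff)
  moreover have "dynkin (\<lambda>w :: 'a list. if w = [] then 1 else 0 :: 'b) t = 0" for t :: "'a magma"
  proof -
    have "dynkin (\<lambda>_. 0 :: 'b) t = 0" for t :: "'a magma"
      using fun_cong[OF dynkin_zero[where 'b='b], of t] by (simp add: zero_fun_def)
    then show ?thesis
      by (cases "(\<lambda>w :: 'a list. if w = [] then 1 else 0 :: 'b, t)" rule: dynkin.cases) auto
  qed
  ultimately show "dynkin (letter i) t = (single 1 (Gen i) t :: 'b)"
    by (cases "(letter i :: 'a list \<Rightarrow> 'b, t)" rule: dynkin.cases)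
      (auto simp: single_def letter_def)
qed

fun right_normed :: "'x magma \<Rightarrow> bool" where
  "right_normed (Gen i) \<longleftrightarrow> True"
| "right_normed (Node (Gen i) t) \<longleftrightarrow> right_normed t"
| "right_normed (Node (Node r s) t) \<longleftrightarrow> False"

lemma dynkin_nonzero:
  assumes "dynkin p t \<noteq> 0" "vanishes_below n p"
  shows "right_normed t \<and> n \<le> leaf_count t"
  using assms
proof (induction p t arbitrary: n rule: dynkin.induct)
  case (1 p j)
  then show ?case by (auto simp: vanishes_below_def not_less[symmetric])
next
  case (2 p i t)
  \<comment> \<open>Shifting the series by a letter lowers its order by at most one, and the leaf
    \<open>Gen i\<close> makes up for it.\<close>
  then have "right_normed t \<and> n - 1 \<le> leaf_count t"
    by (intro 2(1)) (auto simp: vanishes_below_def)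
  then show ?case by auto
qed auto

text \<open>In a Lie algebra left multiplication by a bracket is the commutator of the left
  multiplications, by the Jacobi identity. Since \<open>theta\<close> turns products of series into
  compositions, the expansion of a tree acts, modulo Lie relations, as left multiplication by that
  tree.\<close>

lemma theta_lie_poly:
  fixes u :: "nat magma \<Rightarrow> 'k::field"
  assumes "leaves t \<subseteq> {..<g}" "u \<in> carrier (free_nonassoc g)"
  shows "theta (lie_poly t) u - magma_prod (single 1 t) u \<in> lie_ideal g"
  using assms
proof (induction t arbitrary: u)
  case (Gen i)
  have "theta (lie_poly (Gen i)) u - magma_prod (single 1 (Gen i)) u = 0" by (simp add: theta_letter)
  then show ?case by (simp only: lie_ideal_closed(2))
next
  case (Node s t)
  let ?I = "lie_ideal g :: (nat magma \<Rightarrow> 'k) set"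
  have s: "leaves s \<subseteq> {..<g}" and t: "leaves t \<subseteq> {..<g}" using Node.prems(1) by auto
  have step: "theta (lie_poly a) (theta (lie_poly b) u)
      - magma_prod (single 1 a) (magma_prod (single 1 b) u) \<in> ?I"
    if a: "leaves a \<subseteq> {..<g}" and b: "leaves b \<subseteq> {..<g}"
      and IHa: "\<And>u. u \<in> carrier (free_nonassoc g) \<Longrightarrow> theta (lie_poly a) u - magma_prod (single 1 a) u \<in> ?I"
      and IHb: "theta (lie_poly b) u - magma_prod (single 1 b) u \<in> ?I"
    for a b :: "nat magma"
  proof -
    \<comment> \<open>The inner action is known only up to an error \<open>r\<close> in the ideal.
      By the hypothesis for \<open>a\<close>, the outer action on \<open>r\<close> agrees with left
      multiplication by \<open>a\<close> modulo the ideal, so it keeps \<open>r\<close>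
      inside.\<close>
    define r where "r = theta (lie_poly b) u - magma_prod (single 1 b) u"
    have r: "r \<in> ?I" using IHb by (simp add: r_def)
    have eq: "theta (lie_poly b) u = magma_prod (single 1 b) u + r" by (simp add: r_def)
    have bu: "magma_prod (single 1 b) u \<in> carrier (free_nonassoc g)"
      using b Node.prems(2) by (intro free_nonassoc_closed(2)) simp_all
    have "theta (lie_poly a) (theta (lie_poly b) u) - magma_prod (single 1 a) (magma_prod (single 1 b) u)
      = (theta (lie_poly a) (magma_prod (single 1 b) u) - magma_prod (single 1 a) (magma_prod (single 1 b) u))
        + ((theta (lie_poly a) r - magma_prod (single 1 a) r) + magma_prod (single 1 a) r)"
      by (simp add: eq theta_linear_right)
    also have "\<dots> \<in> ?I"
      using a r bu by (intro lie_ideal_closed(3) lie_ideal_closed(6) IHa)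
        (auto intro: lie_ideal_closed(1))
    finally show ?thesis .
  qed
  let ?s = "single 1 s :: nat magma \<Rightarrow> 'k" and ?t = "single 1 t :: nat magma \<Rightarrow> 'k"
  let ?X = "theta (lie_poly s) (theta (lie_poly t) u)" and ?Y = "theta (lie_poly t) (theta (lie_poly s) u)"
  have carr: "?s \<in> carrier (free_nonassoc g)" "?t \<in> carrier (free_nonassoc g)" using s t by auto
  have X: "?X - magma_prod ?s (magma_prod ?t u) \<in> ?I"
    by (rule step[OF s t Node.IH(1)[OF s] Node.IH(2)[OF t Node.prems(2)]])
  have Y: "?Y - magma_prod ?t (magma_prod ?s u) \<in> ?I"
    by (rule step[OF t s Node.IH(2)[OF t] Node.IH(1)[OF s Node.prems(2)]])
  \<comment> \<open>The Jacobi relator \<open>J\<close> has \<open>u\<close> on the left in two of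
    its products; subtracting \<open>C\<close> and \<open>D\<close> moves \<open>u\<close> to the
    right and leaves the difference of \<open>s (t u)\<close>, \<open>t (s u)\<close> and
    \<open>(s t) u\<close>.\<close>
  have J: "magma_prod ?s (magma_prod ?t u) + magma_prod ?t (magma_prod u ?s) + magma_prod u (magma_prod ?s ?t) \<in> ?I"
    using carr Node.prems(2) by (rule lie_ideal_jacobi)
  have C: "magma_prod u (magma_prod ?s ?t) + magma_prod (magma_prod ?s ?t) u \<in> ?I"
    using carr Node.prems(2) by (intro lie_ideal_anticommutative free_nonassoc_closed(2))
  have D: "magma_prod ?t (magma_prod u ?s + magma_prod ?s u) \<in> ?I"
    using carr Node.prems(2) by (intro lie_ideal_closed(6) lie_ideal_anticommutative)
  have prod_st: "single 1 (Node s t) = magma_prod ?s ?t" by (simp add: magma_prod_single)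
  have "theta (lie_poly (Node s t)) u - magma_prod (single 1 (Node s t)) u
      = (?X - magma_prod ?s (magma_prod ?t u)) - (?Y - magma_prod ?t (magma_prod ?s u))
        + ((magma_prod ?s (magma_prod ?t u) + magma_prod ?t (magma_prod u ?s) + magma_prod u (magma_prod ?s ?t))
          - (magma_prod u (magma_prod ?s ?t) + magma_prod (magma_prod ?s ?t) u)
          - magma_prod ?t (magma_prod u ?s + magma_prod ?s u))"
    by (simp add: theta_diff_left theta_conv magma_prod_linear prod_st)
  also have "\<dots> \<in> ?I"
    by (intro lie_ideal_closed(3) lie_ideal_closed(4) X Y J C D)
  finally show ?case .
qed

lemma theta_lie_poly_lie_ideal:
  fixes r :: "nat magma \<Rightarrow> 'k::field"
  assumes "leaves t \<subseteq> {..<g}" "r \<in> lie_ideal g"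
  shows "theta (lie_poly t) r \<in> lie_ideal g"
proof -
  have "theta (lie_poly t) r = (theta (lie_poly t) r - magma_prod (single 1 t) r) + magma_prod (single 1 t) r"
    by simp
  also have "\<dots> \<in> lie_ideal g"
    using assms by (intro lie_ideal_closed(3) lie_ideal_closed(6) theta_lie_poly) (auto intro: lie_ideal_closed(1))
  finally show ?thesis .
qed

text \<open>The Dynkin-Specht-Wever identity modulo Lie relations. At a node the two halves of the
  commutator give the degree of \<open>t\<close> times the product \<open>s t\<close> and minus the
  degree of \<open>s\<close> times \<open>t s\<close>; anticommutativity adds the two
  degrees.\<close>

lemma dynkin_lie_poly:
  assumes "leaves t \<subseteq> {..<g}"
  shows "dynkin (lie_poly t) - scale (of_nat (leaf_count t)) (single (1 :: 'k::field) t) \<in> lie_ideal g"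
  using assms
proof (induction t)
  case (Gen i)
  have "dynkin (lie_poly (Gen i)) - scale (of_nat (leaf_count (Gen i))) (single (1 :: 'k) (Gen i)) = 0"
    by (simp add: dynkin_letter scale_algebra)
  then show ?case by (simp only: lie_ideal_closed(2))
next
  case (Node s t)
  let ?I = "lie_ideal g :: (nat magma \<Rightarrow> 'k) set"
  have step: "theta (lie_poly a) (dynkin (lie_poly b))
      - scale (of_nat (leaf_count b)) (magma_prod (single 1 a) (single 1 b)) \<in> ?I"
    if a: "leaves a \<subseteq> {..<g}" and b: "leaves b \<subseteq> {..<g}"
      and IH: "dynkin (lie_poly b) - scale (of_nat (leaf_count b)) (single 1 b) \<in> ?I"
    for a b :: "nat magma"
  proof -
    have "theta (lie_poly a) (dynkin (lie_poly b))
        - scale (of_nat (leaf_count b)) (magma_prod (single 1 a) (single 1 b))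
      = theta (lie_poly a) (dynkin (lie_poly b) - scale (of_nat (leaf_count b)) (single 1 b))
        + scale (of_nat (leaf_count b)) (theta (lie_poly a) (single 1 b) - magma_prod (single 1 a) (single 1 b))"
      by (simp add: theta_diff_right theta_linear_right scale_algebra)
    also have "\<dots> \<in> ?I"
      using a b IH by (intro lie_ideal_closed(3) lie_ideal_closed(5) theta_lie_poly theta_lie_poly_lie_ideal) auto
    finally show ?thesis .
  qed
  have s: "leaves s \<subseteq> {..<g}" and t: "leaves t \<subseteq> {..<g}" using Node.prems by auto
  let ?s = "single 1 s :: nat magma \<Rightarrow> 'k" and ?t = "single 1 t :: nat magma \<Rightarrow> 'k"
  \<comment> \<open>Trees have no constant term, which is the side condition of
    \<open>dynkin_conv\<close>.\<close>
  have empty: "lie_poly t [] = (0 :: 'k)" for t :: "nat magma"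
    using lie_poly_homogeneous[of t "[]"] leaf_count_nonzero[of t] by force
  have C: "magma_prod ?s ?t + magma_prod ?t ?s \<in> ?I"
    using s t by (intro lie_ideal_anticommutative) auto
  have "dynkin (lie_poly (Node s t)) - scale (of_nat (leaf_count (Node s t))) (single 1 (Node s t))
     = (theta (lie_poly s) (dynkin (lie_poly t)) - scale (of_nat (leaf_count t)) (magma_prod ?s ?t))
       - (theta (lie_poly t) (dynkin (lie_poly s)) - scale (of_nat (leaf_count s)) (magma_prod ?t ?s))
       - scale (of_nat (leaf_count s)) (magma_prod ?s ?t + magma_prod ?t ?s)"
    by (simp add: dynkin_diff dynkin_conv empty magma_prod_single scale_def fun_eq_iff algebra_simps)
  also have "\<dots> \<in> ?I"
    by (intro lie_ideal_closed(4) lie_ideal_closed(5) C step s t Node.IH)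
  finally show ?case .
qed

lemma dynkin_lie_series:
  fixes f :: "nat magma \<Rightarrow> 'k::field"
  assumes "f \<in> carrier (free_nonassoc g)"
  shows "dynkin (lie_series f) - (\<lambda>t. of_nat (leaf_count t) * f t) \<in> lie_ideal g"
  using assms
proof (induction rule: free_nonassoc_induct)
  case zero
  have "(\<lambda>t. of_nat (leaf_count t) * (0 :: nat magma \<Rightarrow> 'k) t) = 0" by (simp add: fun_eq_iff)
  then show ?case by (simp only: lie_series_zero dynkin_zero diff_0_right lie_ideal_closed(2))
next
  case (add f c t)
  have "lie_series (f + single c t) = lie_series f + scale c (lie_poly t)"
    using add(2,3) by (subst lie_series_add) (auto simp: free_nonassoc_carrier single_def lie_series_single[unfolded single_def])
  then have "dynkin (lie_series (f + single c t)) =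
      dynkin (lie_series f) + scale c (dynkin (lie_poly t))"
    by (simp only: dynkin_linear)
  then have "dynkin (lie_series (f + single c t)) - (\<lambda>s. of_nat (leaf_count s) * (f + single c t) s)
     = (dynkin (lie_series f) - (\<lambda>s. of_nat (leaf_count s) * f s))
      + scale c (dynkin (lie_poly t) - scale (of_nat (leaf_count t)) (single 1 t))"
    by (simp only:) (simp add: fun_eq_iff scale_def single_def algebra_simps)
  also have "\<dots> \<in> lie_ideal g"
    using add by (intro lie_ideal_closed(3) lie_ideal_closed(5) dynkin_lie_poly)
  finally show ?case .
qed

section \<open>Filtration by the order of the series\<close>

definition lie_filtration :: "nat \<Rightarrow> nat \<Rightarrow> (nat magma \<Rightarrow> 'k::field) set" where
  "lie_filtration g n = {f \<in> carrier (free_nonassoc g). vanishes_below n (lie_series f)}"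

lemma lie_filtration_closed:
  fixes f h :: "nat magma \<Rightarrow> 'k::field"
  assumes f: "f \<in> lie_filtration g n"
  shows "f \<in> carrier (free_nonassoc g)"
    and "m \<le> n \<Longrightarrow> f \<in> lie_filtration g m"
    and "h \<in> lie_filtration g n \<Longrightarrow> f + h \<in> lie_filtration g n"
    and "h \<in> lie_filtration g n \<Longrightarrow> f - h \<in> lie_filtration g n"
    and "scale c f \<in> lie_filtration g n"
    and "h \<in> lie_filtration g m \<Longrightarrow> magma_prod f h \<in> lie_filtration g (n + m)"
proof -
  have fin: "finite {t. f t \<noteq> 0}" if "f \<in> carrier (free_nonassoc g)" for f :: "nat magma \<Rightarrow> 'k"
    using that by (simp add: free_nonassoc_carrier)
  show "f \<in> carrier (free_nonassoc g)" "m \<le> n \<Longrightarrow> f \<in> lie_filtration g m"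
    "h \<in> lie_filtration g n \<Longrightarrow> f + h \<in> lie_filtration g n"
    "h \<in> lie_filtration g n \<Longrightarrow> f - h \<in> lie_filtration g n"
    "scale c f \<in> lie_filtration g n"
    using f by (auto simp: lie_filtration_def lie_series_add[OF fin fin] lie_series_diff[OF fin fin]
        lie_series_scale free_nonassoc_closed vanishes_below_add vanishes_below_diff
        intro: vanishes_below_mono vanishes_below_scale)
  show "magma_prod f h \<in> lie_filtration g (n + m)" if "h \<in> lie_filtration g m"
    using f that vanishes_below_conv[of n "lie_series f" m "lie_series h"]
      vanishes_below_conv[of m "lie_series h" n "lie_series f"]
    by (auto simp: lie_filtration_def lie_series_magma_prod[of _ g] free_nonassoc_closed
        add.commute intro: vanishes_below_diff)
qed

text \<open>Every tree has a leaf, so no series has a constant term.\<close>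

lemma lie_filtration_1:
  "lie_filtration g 1 = (carrier (free_nonassoc g) :: (nat magma \<Rightarrow> 'k::field) set)"
proof -
  have "lie_poly t [] = (0 :: 'k)" for t :: "nat magma"
    using lie_poly_homogeneous[of t "[]"] leaf_count_nonzero[of t] by force
  then show ?thesis
    by (auto simp: lie_filtration_def vanishes_below_def lie_series_def)
qed

lemma lie_ideal_subset_filtration: "lie_ideal g \<subseteq> lie_filtration g n"
  using lie_ideal_closed(1) by (auto simp: lie_filtration_def lie_series_lie_ideal)

text \<open>The Dynkin map multiplies each tree by its degree modulo Lie relations. Dividing by the
  degrees beforehand recovers \<open>f\<close> as a combination of right-normed trees, and the order
  of the series bounds their number of leaves from below.\<close>

lemma lie_filtration_right_normed:
  fixes f :: "nat magma \<Rightarrow> 'k::field_char_0"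
  assumes f: "f \<in> lie_filtration g n"
  obtains h where "h \<in> carrier (free_nonassoc g)" "f - h \<in> lie_ideal g"
    "\<And>t. h t \<noteq> 0 \<Longrightarrow> right_normed t \<and> n \<le> leaf_count t"
proof -
  define f' where "f' = (\<lambda>t. f t / of_nat (leaf_count t))"
  have f'0: "f' t = 0 \<longleftrightarrow> f t = 0" for t by (simp add: f'_def)
  have f': "f' \<in> carrier (free_nonassoc g)"
    using f by (simp add: lie_filtration_def free_nonassoc_carrier f'0)
  \<comment> \<open>By homogeneity, division by leaf counts becomes division by word length, which
    does not spoil the vanishing on short words.\<close>
  have "lie_series f' w = lie_series f w / of_nat (length w)" for w
  proof -
    have "f' t * lie_poly t w = f t * lie_poly t w / of_nat (length w)" for t
      using lie_poly_homogeneous[of t w, where 'k='k] by (cases "lie_poly t w = (0 :: 'k)") (auto simp: f'_def)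
    then show ?thesis by (simp add: lie_series_def f'0 sum_divide_distrib)
  qed
  then have van: "vanishes_below n (lie_series f')"
    using f by (simp add: lie_filtration_def vanishes_below_def)
  define h where "h = dynkin (lie_series f')"
  have "h - f \<in> lie_ideal g"
    using dynkin_lie_series[OF f'] by (simp add: h_def f'_def)
  then have I: "f - h \<in> lie_ideal g"
    using lie_ideal_closed(4)[OF lie_ideal_closed(2)] by fastforce
  have "h = f - (f - h)" by simp
  then have "h \<in> carrier (free_nonassoc g)"
    using I f by (metis lie_filtration_closed(1) lie_ideal_closed(1) free_nonassoc_closed(4))
  with I show ?thesis using that[of h] dynkin_nonzero[OF _ van] by (auto simp: h_def)
qed

section \<open>Lower central series\<close>

lemma (in nonassoc_algebra) quotient_eq_iff:
  assumes "algebra_ideal I A" "x \<in> carrier A" "y \<in> carrier A"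
  shows "I +> x = I +> y \<longleftrightarrow> x \<ominus> y \<in> I"
proof -
  interpret I: abelian_subgroup I A by (rule ideal_abelian_subgroup[OF assms(1)])
  have "I +> x = I +> y \<longleftrightarrow> x \<in> I +> y"
    using I.a_rcos_self[OF assms(2)] I.a_repr_independence'[OF _ assms(3)] assms by auto
  also have "\<dots> \<longleftrightarrow> x \<ominus> y \<in> I"
    using I.a_rcos_module[OF assms(3,2)] by (simp add: a_minus_def)
  finally show ?thesis .
qed

lemma free_nonassoc_minus:
  fixes f h :: "nat magma \<Rightarrow> 'k::field"
  assumes "f \<in> carrier (free_nonassoc g)" "h \<in> carrier (free_nonassoc g)"
  shows "f \<ominus>\<^bsub>free_nonassoc g\<^esub> h = f - h"
proof -
  interpret A: nonassoc_algebra "free_nonassoc g :: ('k, nat magma \<Rightarrow> 'k) module"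
    by (rule nonassoc_algebra_free_nonassoc)
  have "\<ominus>\<^bsub>free_nonassoc g\<^esub> h = scale (-1) h"
  proof (rule A.add.inv_equality)
    show "scale (-1) h \<oplus>\<^bsub>free_nonassoc g\<^esub> h = \<zero>\<^bsub>free_nonassoc g\<^esub>"
      by (simp add: free_nonassoc_ops scale_def fun_eq_iff)
  qed (use assms free_nonassoc_closed(3) in blast)+
  then show ?thesis by (simp add: a_minus_def free_nonassoc_ops scale_def fun_eq_iff)
qed

text \<open>With \<open>nilp_class\<close> this gives the canonical projections from the free
  nonassociative algebra. Elements of the nested quotients are handled through
  representatives.\<close>

definition lie_class :: "nat \<Rightarrow> (nat magma \<Rightarrow> 'k::field) \<Rightarrow> (nat magma \<Rightarrow> 'k) set" where
  "lie_class g f = lie_ideal g +>\<^bsub>free_nonassoc g\<^esub> f"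

definition nilp_class :: "nat \<Rightarrow> nat \<Rightarrow> (nat magma \<Rightarrow> 'k::field) \<Rightarrow> (nat magma \<Rightarrow> 'k) set set" where
  "nilp_class g c f = lower_central (free_lie g) (c + 1) +>\<^bsub>free_lie g\<^esub> lie_class g f"

lemma free_lie_simps:
  fixes f h :: "nat magma \<Rightarrow> 'k::field"
  shows "carrier (free_lie g :: ('k, _) module) = lie_class g ` carrier (free_nonassoc g)"
    and "\<zero>\<^bsub>free_lie g\<^esub> = (lie_class g 0 :: (nat magma \<Rightarrow> 'k) set)"
    and "\<lbrakk>f \<in> carrier (free_nonassoc g); h \<in> carrier (free_nonassoc g)\<rbrakk> \<Longrightarrow>
      lie_class g f \<oplus>\<^bsub>free_lie g\<^esub> lie_class g h = lie_class g (f + h)"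
    and "\<lbrakk>f \<in> carrier (free_nonassoc g); h \<in> carrier (free_nonassoc g)\<rbrakk> \<Longrightarrow>
      lie_class g f \<otimes>\<^bsub>free_lie g\<^esub> lie_class g h = lie_class g (magma_prod f h)"
    and "f \<in> carrier (free_nonassoc g) \<Longrightarrow> a \<odot>\<^bsub>free_lie g\<^esub> lie_class g f = lie_class g (scale a f)"
    and "\<lbrakk>f \<in> carrier (free_nonassoc g); h \<in> carrier (free_nonassoc g)\<rbrakk> \<Longrightarrow>
      lie_class g f = lie_class g h \<longleftrightarrow> f - h \<in> lie_ideal g"
proof -
  interpret A: nonassoc_algebra "free_nonassoc g :: ('k, nat magma \<Rightarrow> 'k) module"
    by (rule nonassoc_algebra_free_nonassoc)
  note simps = A.quotient_simps[OF algebra_ideal_lie_ideal, folded lie_class_def free_lie_def]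
  show "carrier (free_lie g :: ('k, _) module) = lie_class g ` carrier (free_nonassoc g)"
    by (auto simp: simps(1))
  show "\<zero>\<^bsub>free_lie g\<^esub> = (lie_class g 0 :: (nat magma \<Rightarrow> 'k) set)"
    using simps(2) by (simp add: free_nonassoc_ops)
  show "lie_class g f \<oplus>\<^bsub>free_lie g\<^esub> lie_class g h = lie_class g (f + h)"
    "lie_class g f \<otimes>\<^bsub>free_lie g\<^esub> lie_class g h = lie_class g (magma_prod f h)"
    if "f \<in> carrier (free_nonassoc g)" "h \<in> carrier (free_nonassoc g)"
    using simps(3,4)[OF that] by (simp_all add: free_nonassoc_ops)
  show "a \<odot>\<^bsub>free_lie g\<^esub> lie_class g f = lie_class g (scale a f)" if "f \<in> carrier (free_nonassoc g)"
    using simps(5)[OF that] by (simp add: free_nonassoc_ops)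
  show "lie_class g f = lie_class g h \<longleftrightarrow> f - h \<in> lie_ideal g"
    if "f \<in> carrier (free_nonassoc g)" "h \<in> carrier (free_nonassoc g)"
    using A.quotient_eq_iff[OF algebra_ideal_lie_ideal that] that
    by (simp add: lie_class_def free_nonassoc_minus)
qed

lemma free_lie_uminus:
  fixes f :: "nat magma \<Rightarrow> 'k::field"
  assumes "f \<in> carrier (free_nonassoc g)"
  shows "\<ominus>\<^bsub>free_lie g\<^esub> lie_class g f = lie_class g (scale (-1) f)"
proof -
  interpret F: lie_algebra "free_lie g :: ('k, _) module" by (rule lie_algebra_free_lie)
  have "scale (-1) f + f = 0" by (simp add: scale_def fun_eq_iff)
  then show ?thesis
    using assms free_nonassoc_closed(3)[OF assms, of "-1"]
    by (intro F.add.inv_equality) (simp_all add: free_lie_simps)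
qed

lemma free_lie_minus:
  fixes f h :: "nat magma \<Rightarrow> 'k::field"
  assumes "f \<in> carrier (free_nonassoc g)" "h \<in> carrier (free_nonassoc g)"
  shows "lie_class g f \<ominus>\<^bsub>free_lie g\<^esub> lie_class g h = lie_class g (f - h)"
proof -
  have "f - h = f + scale (-1) h" by (simp add: scale_def fun_eq_iff)
  then show ?thesis
    using assms free_nonassoc_closed(3)[OF assms(2), of "-1"]
    by (simp only: a_minus_def free_lie_uminus free_lie_simps(3))
qed

text \<open>Orders add under brackets, which gives one inclusion. Conversely, an element of order at
  least two is a combination of right-normed trees with at least as many leaves as its order; each
  is a generator bracketed with a tree of one degree less, to which the induction hypothesis
  applies.\<close>

lemma lower_central_free_lie:
  "lower_central (free_lie g :: ('k::field_char_0, _) module) (Suc n) =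
    lie_class g ` lie_filtration g (Suc n)"
proof (induction n)
  case 0
  show ?case by (simp add: free_lie_simps lie_filtration_1[unfolded One_nat_def])
next
  case (Suc n)
  let ?F = "free_lie g :: ('k, _) module"
  let ?N = "lie_class g ` lie_filtration g (Suc (Suc n)) :: (nat magma \<Rightarrow> 'k) set set"
  let ?S = "{u \<otimes>\<^bsub>?F\<^esub> v | u v. u \<in> carrier ?F \<and> v \<in> lower_central ?F (Suc n)}"
  interpret F: lie_algebra ?F by (rule lie_algebra_free_lie)
  have S: "?S \<subseteq> carrier ?F"
    using F.lower_central_ideal[of "Suc n"] F.submoduleE(1) F.mult_closed
    by (fastforce simp: algebra_ideal_def simp del: lower_central.simps)
  note span = F.linear_span[OF S]
  have sub: "submodule ?N (ring_of_type_algebra :: 'k ring) ?F"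
  proof (rule F.submoduleI)
    show "?N \<subseteq> carrier ?F" by (auto simp: free_lie_simps lie_filtration_closed(1))
    show "\<zero>\<^bsub>?F\<^esub> \<in> ?N"
      using lie_ideal_closed(2) lie_ideal_subset_filtration by (fastforce simp: free_lie_simps)
    show "\<ominus>\<^bsub>?F\<^esub> a \<in> ?N" if "a \<in> ?N" for a
      using that by (auto simp: free_lie_uminus lie_filtration_closed(1) intro: lie_filtration_closed(5))
    show "a \<oplus>\<^bsub>?F\<^esub> b \<in> ?N" if "a \<in> ?N" "b \<in> ?N" for a b
      using that by (auto simp: free_lie_simps lie_filtration_closed(1) intro: lie_filtration_closed(3))
    show "a \<odot>\<^bsub>?F\<^esub> x \<in> ?N" if "x \<in> ?N" for a x
      using that by (auto simp: free_lie_simps lie_filtration_closed(1) intro: lie_filtration_closed(5))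
  qed
  have "?S \<subseteq> ?N"
  proof
    fix x assume "x \<in> ?S"
    then obtain f h where "f \<in> lie_filtration g 1" "h \<in> lie_filtration g (Suc n)"
      "x = lie_class g f \<otimes>\<^bsub>?F\<^esub> lie_class g h"
      unfolding Suc.IH free_lie_simps(1) lie_filtration_1 by blast
    then show "x \<in> ?N"
      using lie_filtration_closed(6)[of f g 1 h "Suc n"]
      by (auto simp: free_lie_simps lie_filtration_closed(1))
  qed
  with sub have "linear_span ?F ?S \<subseteq> ?N" by (rule span(3))
  moreover have "?N \<subseteq> linear_span ?F ?S"
  proof
    fix x assume "x \<in> ?N"
    then obtain f where f: "x = lie_class g f" "f \<in> lie_filtration g (Suc (Suc n))" by blast
    obtain h where h: "h \<in> carrier (free_nonassoc g)" "f - h \<in> lie_ideal g"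
      "\<And>t. h t \<noteq> 0 \<Longrightarrow> right_normed t \<and> Suc (Suc n) \<le> leaf_count t"
      using lie_filtration_right_normed[OF f(2)] by blast
    \<comment> \<open>A right-normed tree with at least two leaves has a generator as its left
      branch, and the scalar \<open>c\<close> is absorbed by this generator.\<close>
    have tree: "lie_class g (single c t) \<in> linear_span ?F ?S"
      if "leaves t \<subseteq> {..<g}" "right_normed t" "Suc (Suc n) \<le> leaf_count t" for c t
      using that
    proof (cases t rule: right_normed.cases)
      case (2 i s)
      have eq: "lie_class g (single c t) = lie_class g (single c (Gen i)) \<otimes>\<^bsub>?F\<^esub> lie_class g (single 1 s)"
        using 2 that by (simp add: free_lie_simps magma_prod_single)
      have "vanishes_below (Suc n) (lie_poly s :: nat list \<Rightarrow> 'k)"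
        using 2 that lie_poly_homogeneous[of s, where 'k='k] by (fastforce simp: vanishes_below_def)
      then have "single 1 s \<in> (lie_filtration g (Suc n) :: (nat magma \<Rightarrow> 'k) set)"
        using 2 that by (simp add: lie_filtration_def lie_series_single scale_algebra)
      then have "lie_class g (single c t) \<in> ?S"
        unfolding Suc.IH free_lie_simps(1) eq using 2 that by fastforce
      then show ?thesis using span(2) by blast
    qed auto
    note E = F.submoduleE[OF span(1)]
    from h(1) have "lie_class g h \<in> linear_span ?F ?S"
    proof (induction rule: free_nonassoc_induct)
      case zero
      obtain x where x: "x \<in> linear_span ?F ?S" using E(2) by blast
      have "\<zero>\<^bsub>ring_of_type_algebra\<^esub> \<odot>\<^bsub>?F\<^esub> x = \<zero>\<^bsub>?F\<^esub>"
        using x E(1) by (intro F.smult_l_null) blast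
      moreover have "\<zero>\<^bsub>ring_of_type_algebra\<^esub> \<odot>\<^bsub>?F\<^esub> x \<in> linear_span ?F ?S"
        using x by (intro E(4)) simp_all
      ultimately have "\<zero>\<^bsub>?F\<^esub> \<in> linear_span ?F ?S" by simp
      then show ?case by (simp only: free_lie_simps(2))
    next
      case (add h' c t)
      have "lie_class g (h' + single c t) = lie_class g h' \<oplus>\<^bsub>?F\<^esub> lie_class g (single c t)"
        using add by (simp add: free_lie_simps)
      then show ?case using E(5) add tree h(3) by (metis (no_types, lifting))
    qed
    moreover have "lie_class g f = lie_class g h"
      using h f lie_filtration_closed(1) by (subst free_lie_simps(6)) blast+
    ultimately show "x \<in> linear_span ?F ?S" using f by simp
  qed
  ultimately show ?case by (simp add: bracket_space_def)
qed

text \<open>The last clause is the decisive one: equality in F_{g,c} becomes a condition on the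
  series of a difference of representatives.\<close>

lemma free_nilpotent_lie_simps:
  fixes f h :: "nat magma \<Rightarrow> 'k::field_char_0"
  shows "carrier (free_nilpotent_lie g c :: ('k, _) module) = nilp_class g c ` carrier (free_nonassoc g)"
    and "\<zero>\<^bsub>free_nilpotent_lie g c\<^esub> = (nilp_class g c 0 :: (nat magma \<Rightarrow> 'k) set set)"
    and "\<lbrakk>f \<in> carrier (free_nonassoc g); h \<in> carrier (free_nonassoc g)\<rbrakk> \<Longrightarrow>
      nilp_class g c f \<oplus>\<^bsub>free_nilpotent_lie g c\<^esub> nilp_class g c h = nilp_class g c (f + h)"
    and "\<lbrakk>f \<in> carrier (free_nonassoc g); h \<in> carrier (free_nonassoc g)\<rbrakk> \<Longrightarrow>
      nilp_class g c f \<otimes>\<^bsub>free_nilpotent_lie g c\<^esub> nilp_class g c h = nilp_class g c (magma_prod f h)"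
    and "f \<in> carrier (free_nonassoc g) \<Longrightarrow>
      a \<odot>\<^bsub>free_nilpotent_lie g c\<^esub> nilp_class g c f = nilp_class g c (scale a f)"
    and "\<lbrakk>f \<in> carrier (free_nonassoc g); h \<in> carrier (free_nonassoc g)\<rbrakk> \<Longrightarrow>
      nilp_class g c f = nilp_class g c h \<longleftrightarrow> f - h \<in> lie_filtration g (c + 1)"
proof -
  interpret F: lie_algebra "free_lie g :: ('k, _) module" by (rule lie_algebra_free_lie)
  have ideal: "algebra_ideal (lower_central (free_lie g) (c + 1)) (free_lie g :: ('k, _) module)"
    by (rule F.lower_central_ideal)
  have carr: "lie_class g f \<in> carrier (free_lie g)" if "f \<in> carrier (free_nonassoc g)"
    for f :: "nat magma \<Rightarrow> 'k"
    using that by (simp add: free_lie_simps)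
  note simps = F.quotient_simps[OF ideal, folded free_nilpotent_lie_def]
  show "carrier (free_nilpotent_lie g c :: ('k, _) module) = nilp_class g c ` carrier (free_nonassoc g)"
    by (auto simp: simps(1) nilp_class_def free_lie_simps)
  show "\<zero>\<^bsub>free_nilpotent_lie g c\<^esub> = (nilp_class g c 0 :: (nat magma \<Rightarrow> 'k) set set)"
    by (simp only: simps(2) nilp_class_def free_lie_simps(2))
  show "nilp_class g c f \<oplus>\<^bsub>free_nilpotent_lie g c\<^esub> nilp_class g c h = nilp_class g c (f + h)"
    "nilp_class g c f \<otimes>\<^bsub>free_nilpotent_lie g c\<^esub> nilp_class g c h = nilp_class g c (magma_prod f h)"
    if "f \<in> carrier (free_nonassoc g)" "h \<in> carrier (free_nonassoc g)"
    using simps(3,4)[OF carr carr] that by (simp_all only: nilp_class_def free_lie_simps(3,4))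
  show "a \<odot>\<^bsub>free_nilpotent_lie g c\<^esub> nilp_class g c f = nilp_class g c (scale a f)"
    if "f \<in> carrier (free_nonassoc g)"
    using simps(5)[OF carr] that by (simp only: nilp_class_def free_lie_simps(5))
  show "nilp_class g c f = nilp_class g c h \<longleftrightarrow> f - h \<in> lie_filtration g (c + 1)"
    if fh: "f \<in> carrier (free_nonassoc g)" "h \<in> carrier (free_nonassoc g)"
  proof -
    have "nilp_class g c f = nilp_class g c h \<longleftrightarrow>
        lie_class g (f - h) \<in> lie_class g ` lie_filtration g (c + 1)"
      using F.quotient_eq_iff[OF ideal carr carr] fh
      by (simp add: nilp_class_def free_lie_minus lower_central_free_lie del: lower_central.simps)
    also have "\<dots> \<longleftrightarrow> f - h \<in> lie_filtration g (c + 1)"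
    proof
      assume "lie_class g (f - h) \<in> lie_class g ` lie_filtration g (c + 1)"
      \<comment> \<open>The representative \<open>k\<close> agrees with \<open>f - h\<close> only up
        to Lie relations, which lie in every step of the filtration.\<close>
      then obtain k where k: "k \<in> lie_filtration g (c + 1)" "lie_class g (f - h) = lie_class g k" by blast
      then have "f - h - k \<in> lie_ideal g"
        using fh by (simp add: free_lie_simps(6) free_nonassoc_closed(4) lie_filtration_closed(1))
      then have "(f - h - k) + k \<in> lie_filtration g (c + 1)"
        using k lie_ideal_subset_filtration by (intro lie_filtration_closed(3)) blast+
      then show "f - h \<in> lie_filtration g (c + 1)" by simp
    qed blast
    finally show ?thesis .
  qed
qed

section \<open>Commutative post-Lie structures on free-nilpotent Lie algebras\<close>

text \<open>The axioms are identities, so a surjective homomorphism compatible with the two products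
  transports them. This is used to descend to F_{g,3}.\<close>

lemma cpa_structure_surjective_image:
  fixes L :: "('k::field, 'v) module" and M :: "('k, 'w) module"
  assumes "cpa_structure L p" and "lie_algebra M"
    and surj: "carrier M = \<rho> ` carrier L"
    and add: "\<And>x y. \<lbrakk>x \<in> carrier L; y \<in> carrier L\<rbrakk> \<Longrightarrow> \<rho> (x \<oplus>\<^bsub>L\<^esub> y) = \<rho> x \<oplus>\<^bsub>M\<^esub> \<rho> y"
    and mult: "\<And>x y. \<lbrakk>x \<in> carrier L; y \<in> carrier L\<rbrakk> \<Longrightarrow> \<rho> (x \<otimes>\<^bsub>L\<^esub> y) = \<rho> x \<otimes>\<^bsub>M\<^esub> \<rho> y"
    and smult: "\<And>a x. x \<in> carrier L \<Longrightarrow> \<rho> (a \<odot>\<^bsub>L\<^esub> x) = a \<odot>\<^bsub>M\<^esub> \<rho> x"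
    and q: "\<And>x y. \<lbrakk>x \<in> carrier L; y \<in> carrier L\<rbrakk> \<Longrightarrow> q (\<rho> x) (\<rho> y) = \<rho> (p x y)"
  shows "cpa_structure M q"
proof -
  interpret L: cpa_structure L p by fact
  interpret M: lie_algebra M by fact
  have carr: "\<rho> x \<in> carrier M" if "x \<in> carrier L" for x using surj that by blast
  have zero: "\<rho> \<zero>\<^bsub>L\<^esub> = \<zero>\<^bsub>M\<^esub>"
    using add[of "\<zero>\<^bsub>L\<^esub>" "\<zero>\<^bsub>L\<^esub>"] carr[of "\<zero>\<^bsub>L\<^esub>"] by (simp add: M.add.l_cancel_one')
  have uminus: "\<rho> (\<ominus>\<^bsub>L\<^esub> x) = \<ominus>\<^bsub>M\<^esub> \<rho> x" if "x \<in> carrier L" for x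
    using that add[of "\<ominus>\<^bsub>L\<^esub> x" x] zero carr
    by (intro M.add.inv_equality[symmetric]) (simp_all add: L.l_neg)
  have minus: "\<rho> (x \<ominus>\<^bsub>L\<^esub> y) = \<rho> x \<ominus>\<^bsub>M\<^esub> \<rho> y" if "x \<in> carrier L" "y \<in> carrier L" for x y
    using that by (simp add: a_minus_def add uminus)
  note simps = add[symmetric] mult[symmetric] smult[symmetric] minus[symmetric] q
    L.cpa_closed L.mult_closed L.smult_closed
  show ?thesis
  proof (intro cpa_structure.intro cpa_structure_axioms.intro)
    fix U Y :: 'w assume "U \<in> carrier M" "Y \<in> carrier M"
    then obtain x y where xy: "U = \<rho> x" "x \<in> carrier L" "Y = \<rho> y" "y \<in> carrier L"
      unfolding surj by blast
    show "q U Y \<in> carrier M" using xy by (simp add: simps carr)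
    show "q U Y = q Y U" using xy L.cpa_commute by (simp add: simps)
    show "q (a \<odot>\<^bsub>M\<^esub> U) Y = a \<odot>\<^bsub>M\<^esub> q U Y" for a
      using xy L.cpa_smult_left by (simp add: simps)
    show "q U (a \<odot>\<^bsub>M\<^esub> Y) = a \<odot>\<^bsub>M\<^esub> q U Y" for a
      using xy L.cpa_smult_right by (simp add: simps)
    fix Z :: 'w assume "Z \<in> carrier M"
    then obtain z where z: "Z = \<rho> z" "z \<in> carrier L" unfolding surj by blast
    show "q (U \<oplus>\<^bsub>M\<^esub> Y) Z = q U Z \<oplus>\<^bsub>M\<^esub> q Y Z"
      using xy z L.cpa_add_left by (simp add: simps)
    show "q U (Y \<oplus>\<^bsub>M\<^esub> Z) = q U Y \<oplus>\<^bsub>M\<^esub> q U Z"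
      using xy z L.cpa_add_right by (simp add: simps)
    show "q (U \<otimes>\<^bsub>M\<^esub> Y) Z = q U (q Y Z) \<ominus>\<^bsub>M\<^esub> q Y (q U Z)"
      using xy z L.cpa_bracket_left by (simp add: simps)
    show "q U (Y \<otimes>\<^bsub>M\<^esub> Z) = q U Y \<otimes>\<^bsub>M\<^esub> Z \<oplus>\<^bsub>M\<^esub> Y \<otimes>\<^bsub>M\<^esub> q U Z"
      using xy z L.cpa_bracket_right by (simp add: simps)
  qed fact
qed

section \<open>The filtration on F_{g,c} and derivations\<close>

definition nilp_filtration :: "nat \<Rightarrow> nat \<Rightarrow> nat \<Rightarrow> (nat magma \<Rightarrow> 'k::field) set set set" where
  "nilp_filtration g c n = nilp_class g c ` lie_filtration g n"

lemma nilp_filtration_1: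
  "nilp_filtration g c 1 = carrier (free_nilpotent_lie g c :: ('k::field_char_0, _) module)"
  by (simp only: nilp_filtration_def lie_filtration_1 free_nilpotent_lie_simps(1))

text \<open>A representative is determined only up to terms of order \<open>c + 1\<close>, and for
  \<open>n \<le> c + 1\<close> these do not affect membership.\<close>

lemma nilp_class_mem_filtration:
  fixes f :: "nat magma \<Rightarrow> 'k::field_char_0"
  assumes "f \<in> carrier (free_nonassoc g)" "n \<le> c + 1"
  shows "nilp_class g c f \<in> nilp_filtration g c n \<longleftrightarrow> f \<in> lie_filtration g n"
proof
  assume "nilp_class g c f \<in> nilp_filtration g c n"
  then obtain h where h: "h \<in> lie_filtration g n" "nilp_class g c f = nilp_class g c h"
    by (auto simp: nilp_filtration_def)
  then have "f - h \<in> lie_filtration g (c + 1)"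
    using assms(1) lie_filtration_closed(1) by (subst free_nilpotent_lie_simps(6)[symmetric]) auto
  then have "f - h \<in> lie_filtration g n" using assms(2) by (rule lie_filtration_closed(2))
  then have "(f - h) + h \<in> lie_filtration g n" using h(1) by (rule lie_filtration_closed(3))
  then show "f \<in> lie_filtration g n" by simp
qed (auto simp: nilp_filtration_def)

lemma free_nilpotent_lie_minus:
  fixes f h :: "nat magma \<Rightarrow> 'k::field_char_0"
  assumes "f \<in> carrier (free_nonassoc g)" "h \<in> carrier (free_nonassoc g)"
  shows "nilp_class g c f \<ominus>\<^bsub>free_nilpotent_lie g c\<^esub> nilp_class g c h = nilp_class g c (f - h)"
proof -
  interpret L: lie_algebra "free_nilpotent_lie g c :: ('k, _) module"
    by (rule lie_algebra_free_nilpotent_lie)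
  have h': "scale (-1) h \<in> carrier (free_nonassoc g)" using assms(2) by (rule free_nonassoc_closed(3))
  have "scale (-1) h + h = 0" by (simp add: scale_def fun_eq_iff)
  then have "\<ominus>\<^bsub>free_nilpotent_lie g c\<^esub> nilp_class g c h = nilp_class g c (scale (-1) h)"
    using assms h' by (intro L.add.inv_equality) (simp_all add: free_nilpotent_lie_simps)
  moreover have "f - h = f + scale (-1) h" by (simp add: scale_def fun_eq_iff)
  ultimately show ?thesis
    using assms h' by (simp only: a_minus_def free_nilpotent_lie_simps(3))
qed

lemma nilp_filtration_closed:
  fixes U Y :: "(nat magma \<Rightarrow> 'k::field_char_0) set set"
  assumes "U \<in> nilp_filtration g c n"
  shows "U \<in> carrier (free_nilpotent_lie g c)"
    and "m \<le> n \<Longrightarrow> U \<in> nilp_filtration g c m"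
    and "Y \<in> nilp_filtration g c n \<Longrightarrow> U \<oplus>\<^bsub>free_nilpotent_lie g c\<^esub> Y \<in> nilp_filtration g c n"
    and "Y \<in> nilp_filtration g c n \<Longrightarrow> U \<ominus>\<^bsub>free_nilpotent_lie g c\<^esub> Y \<in> nilp_filtration g c n"
    and "a \<odot>\<^bsub>free_nilpotent_lie g c\<^esub> U \<in> nilp_filtration g c n"
    and "Y \<in> nilp_filtration g c m \<Longrightarrow> U \<otimes>\<^bsub>free_nilpotent_lie g c\<^esub> Y \<in> nilp_filtration g c (n + m)"
  using assms
  by (auto simp: nilp_filtration_def free_nilpotent_lie_simps free_nilpotent_lie_minus
      lie_filtration_closed(1) intro: lie_filtration_closed(2-6))

text \<open>A derivation that raises the degree of each generator by \<open>m\<close> raises all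
  degrees by \<open>m\<close>: the Leibniz rule shows it for right-normed trees, and these represent
  every element of the filtration. Generators have degree 1, hence \<open>Suc m\<close>.\<close>

lemma derivation_nilp_filtration:
  fixes g c :: nat and d :: "(nat magma \<Rightarrow> 'k::field_char_0) set set \<Rightarrow> (nat magma \<Rightarrow> 'k) set set"
  defines "L \<equiv> free_nilpotent_lie g c :: ('k, _) module"
  assumes closed: "\<And>U. U \<in> carrier L \<Longrightarrow> d U \<in> carrier L"
    and add: "\<And>U Y. \<lbrakk>U \<in> carrier L; Y \<in> carrier L\<rbrakk> \<Longrightarrow> d (U \<oplus>\<^bsub>L\<^esub> Y) = d U \<oplus>\<^bsub>L\<^esub> d Y"
    and smult: "\<And>a U. U \<in> carrier L \<Longrightarrow> d (a \<odot>\<^bsub>L\<^esub> U) = a \<odot>\<^bsub>L\<^esub> d U"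
    and deriv: "\<And>U Y. \<lbrakk>U \<in> carrier L; Y \<in> carrier L\<rbrakk> \<Longrightarrow>
      d (U \<otimes>\<^bsub>L\<^esub> Y) = d U \<otimes>\<^bsub>L\<^esub> Y \<oplus>\<^bsub>L\<^esub> U \<otimes>\<^bsub>L\<^esub> d Y"
    and gens: "\<And>i. i < g \<Longrightarrow> d (nilp_class g c (single 1 (Gen i))) \<in> nilp_filtration g c (Suc m)"
    and U: "U \<in> nilp_filtration g c n"
  shows "d U \<in> nilp_filtration g c (n + m)"
proof -
  note simps = free_nilpotent_lie_simps[where g = g and c = c and 'k = 'k, folded L_def]
  note closed_filt = nilp_filtration_closed[where g = g and c = c and 'k = 'k, folded L_def]
  have cls: "nilp_class g c (f :: nat magma \<Rightarrow> 'k) \<in> carrier L" if "f \<in> carrier (free_nonassoc g)" for f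
    using that by (simp add: simps)
  have tree: "d (nilp_class g c (single 1 t)) \<in> nilp_filtration g c (leaf_count t + m)"
    if "leaves t \<subseteq> {..<g}" "right_normed t" for t
    using that
  proof (induction t rule: right_normed.induct)
    case (1 i)
    then show ?case using gens[of i] by simp
  next
    case (2 i t)
    let ?i = "nilp_class g c (single (1 :: 'k) (Gen i))" and ?t = "nilp_class g c (single (1 :: 'k) t)"
    have c: "?i \<in> carrier L" "?t \<in> carrier L" using 2 by (auto intro!: cls)
    have "nilp_class g c (single 1 (Node (Gen i) t)) = ?i \<otimes>\<^bsub>L\<^esub> ?t"
      using 2 by (simp add: simps magma_prod_single)
    then have eq: "d (nilp_class g c (single 1 (Node (Gen i) t))) = d ?i \<otimes>\<^bsub>L\<^esub> ?t \<oplus>\<^bsub>L\<^esub> ?i \<otimes>\<^bsub>L\<^esub> d ?t"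
      using deriv[OF c] by simp
    have "vanishes_below (leaf_count t) (lie_poly t :: nat list \<Rightarrow> 'k)"
      using lie_poly_homogeneous[of t, where 'k='k] by (fastforce simp: vanishes_below_def)
    then have "single (1 :: 'k) t \<in> lie_filtration g (leaf_count t)"
      using 2 by (simp add: lie_filtration_def lie_series_single scale_algebra)
    then have t: "?t \<in> nilp_filtration g c (leaf_count t)" by (simp add: nilp_filtration_def)
    have i: "?i \<in> nilp_filtration g c 1" using c(1) nilp_filtration_1[of g c, where 'k='k] by (simp add: L_def)
    have "d ?i \<otimes>\<^bsub>L\<^esub> ?t \<in> nilp_filtration g c (Suc m + leaf_count t)"
      using gens[of i] 2 t by (intro closed_filt(6)) auto
    moreover have "?i \<otimes>\<^bsub>L\<^esub> d ?t \<in> nilp_filtration g c (1 + (leaf_count t + m))"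
      using i 2 by (intro closed_filt(6)) auto
    ultimately show ?case unfolding eq by (intro closed_filt(3)) (simp_all add: add_ac)
  qed simp
  obtain f where f: "f \<in> lie_filtration g n" "U = nilp_class g c f"
    using U by (auto simp: nilp_filtration_def)
  obtain h where h: "h \<in> carrier (free_nonassoc g)" "f - h \<in> lie_ideal g"
    "\<And>t. h t \<noteq> 0 \<Longrightarrow> right_normed t \<and> n \<le> leaf_count t"
    using lie_filtration_right_normed[OF f(1)] by blast
  have "f - h \<in> lie_filtration g (c + 1)" using h(2) lie_ideal_subset_filtration by blast
  then have "U = nilp_class g c h"
    using simps(6)[of f h] f h(1) lie_filtration_closed(1) by blast
  moreover from h(1) have "d (nilp_class g c h) \<in> nilp_filtration g c (n + m)"
  proof (induction rule: free_nonassoc_induct)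
    case zero
    let ?Z = "d (nilp_class g c (0 :: nat magma \<Rightarrow> 'k))"
    have Z: "?Z = 0 \<odot>\<^bsub>L\<^esub> ?Z"
      using smult[OF cls[of 0], of 0] by (simp add: simps scale_algebra)
    obtain z where z: "?Z = nilp_class g c z" "z \<in> carrier (free_nonassoc g)"
      using closed[OF cls[of 0]] by (auto simp: simps)
    have "0 \<odot>\<^bsub>L\<^esub> ?Z = nilp_class g c 0"
      unfolding z(1) using z(2) by (simp add: simps scale_algebra)
    moreover have "(0 :: nat magma \<Rightarrow> 'k) \<in> lie_filtration g (n + m)"
      using lie_ideal_closed(2) lie_ideal_subset_filtration by blast
    ultimately have "?Z \<in> nilp_filtration g c (n + m)" using Z by (simp add: nilp_filtration_def)
    then show ?case .
  next
    case (add h' a t)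
    have t: "single (1 :: 'k) t \<in> carrier (free_nonassoc g)" using add(2) by simp
    have at: "scale a (single 1 t) \<in> carrier (free_nonassoc g)" using t by (rule free_nonassoc_closed(3))
    have "single a t = scale a (single 1 t)" by (simp add: single_def scale_def fun_eq_iff)
    then have "nilp_class g c (h' + single a t) = nilp_class g c h' \<oplus>\<^bsub>L\<^esub> a \<odot>\<^bsub>L\<^esub> nilp_class g c (single 1 t)"
      using add(3) t at by (simp add: simps)
    then have "d (nilp_class g c (h' + single a t)) =
        d (nilp_class g c h') \<oplus>\<^bsub>L\<^esub> a \<odot>\<^bsub>L\<^esub> d (nilp_class g c (single 1 t))"
      using add(3) t cls at smult[OF cls[OF t], of a] assms(3)[OF cls cls, of h' "scale a (single 1 t)"]
      by (simp add: simps)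
    moreover have "d (nilp_class g c (single 1 t)) \<in> nilp_filtration g c (n + m)"
      using tree[OF add(2)] h(3)[OF add(1)] by (auto intro: closed_filt(2))
    ultimately show ?case using add(4) by (simp only: closed_filt(3) closed_filt(5))
  qed
  ultimately show ?thesis by simp
qed

text \<open>By the third axiom, multiplication by a fixed \<open>Z\<close> is a derivation of the
  Lie bracket.\<close>

lemma cpa_nilp_filtration:
  fixes g c :: nat and p :: "(nat magma \<Rightarrow> 'k::field_char_0) set set \<Rightarrow> _"
  assumes "cpa_structure (free_nilpotent_lie g c :: ('k, _) module) p"
    and "Z \<in> carrier (free_nilpotent_lie g c)"
    and "\<And>i. i < g \<Longrightarrow> p Z (nilp_class g c (single 1 (Gen i))) \<in> nilp_filtration g c (Suc m)"
    and "U \<in> nilp_filtration g c n"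
  shows "p Z U \<in> nilp_filtration g c (n + m)"
proof -
  interpret cpa_structure "free_nilpotent_lie g c :: ('k, _) module" p by fact
  show ?thesis
    using assms(2-4)
    by (intro derivation_nilp_filtration) (auto simp: cpa_closed cpa_add_right cpa_smult_right cpa_bracket_right)
qed

lemma lie_series_gen:
  fixes f :: "nat magma \<Rightarrow> 'k::field"
  assumes "f \<in> carrier (free_nonassoc g)" "i < g"
  shows "lie_series (magma_prod f (single 1 (Gen i))) =
      conv (lie_series f) (letter i) - conv (letter i) (lie_series f)"
    and "lie_series (magma_prod (single 1 (Gen i)) f) =
      conv (letter i) (lie_series f) - conv (lie_series f) (letter i)"
  using assms by (simp_all add: lie_series_magma_prod[of _ g] lie_series_single scale_algebra)

text \<open>A graded form of the triviality of the center of the free Lie algebra: the part of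
  degree \<open>n\<close> of \<open>f\<close> commutes with every letter and is therefore
  zero.\<close>

lemma lie_series_centralizer:
  fixes f :: "nat magma \<Rightarrow> 'k::field_char_0"
  assumes "g \<ge> 3" "n \<ge> 1" "f \<in> lie_filtration g n"
    and comm: "\<And>i. i < g \<Longrightarrow> magma_prod f (single 1 (Gen i)) \<in> lie_filtration g (n + 2)"
  shows "f \<in> lie_filtration g (n + 1)"
proof -
  \<comment> \<open>The family is concentrated at index 0. Its equations for a pair of 0 and another
    index say that \<open>f\<close> commutes with that letter up to order \<open>n + 2\<close>; all
    other equations are trivial.\<close>
  define b where "b = (\<lambda>i :: nat. if i = 0 then lie_series f else 0)"
  have f: "f \<in> carrier (free_nonassoc g)" using assms(3) by (rule lie_filtration_closed(1))
  have comm': "vanishes_below (n + 2) (conv (lie_series f) (letter i) - conv (letter i) (lie_series f))"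
    if "i < g" for i
    using comm[OF that] by (simp add: lie_filtration_def lie_series_gen[OF f that])
  have neg: "vanishes_below (n + 2) (0 - (conv (lie_series f) (letter i) - conv (letter i) (lie_series f)))"
    if "i < g" for i
    by (rule vanishes_below_diff[OF vanishes_below_zero comm'[OF that]])
  have "vanishes_below (n + 1) (b 0)"
  proof (rule commutator_system_trivial[OF assms(1,2)])
    show "vanishes_below n (b i)" for i
      using assms(3) by (simp add: b_def lie_filtration_def)
    show "vanishes_below (n + 2) ((conv (b i) (letter j) - conv (letter j) (b i))
        - (conv (b j) (letter i) - conv (letter i) (b j)))" if "i < g" "j < g" for i j
      using comm'[OF that(2)] neg[OF that(1)] by (cases "i = 0"; cases "j = 0") (simp_all add: b_def)
  qed (use assms(1) in simp)
  with f show ?thesis by (simp add: b_def lie_filtration_def)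
qed

text \<open>The product of \<open>Z\<close> with a bracket of two generators is evaluated twice. The
  second axiom expresses it by double products, which have high order; the third expresses it by
  brackets of \<open>Z \<cdot> x_i\<close> with generators. Comparison gives the system of
  \<open>commutator_system_trivial\<close>.\<close>

lemma cpa_filtration_step:
  fixes g c :: nat and p :: "(nat magma \<Rightarrow> 'k::field_char_0) set set \<Rightarrow> _"
  defines "L \<equiv> free_nilpotent_lie g c :: ('k, _) module"
  assumes g: "g \<ge> 3" and n: "3 \<le> n" "n < c" and p: "cpa_structure L p"
    and low: "\<And>U Y. \<lbrakk>U \<in> carrier L; Y \<in> carrier L\<rbrakk> \<Longrightarrow> p U Y \<in> nilp_filtration g c n"
    and Z: "Z \<in> carrier L" and Y: "Y \<in> carrier L"
  shows "p Z Y \<in> nilp_filtration g c (n + 1)"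
proof -
  interpret cpa_structure L p by (rule p)
  note simps = free_nilpotent_lie_simps[where g = g and c = c and 'k = 'k, folded L_def]
  note closed_filt = nilp_filtration_closed[where g = g and c = c and 'k = 'k, folded L_def]
  let ?x = "\<lambda>i. nilp_class g c (single (1 :: 'k) (Gen i))"
  have x: "?x i \<in> carrier L" if "i < g" for i using that by (auto simp: simps)
  \<comment> \<open>The \<open>b i\<close> are representatives of the products of \<open>Z\<close>
    with the generators, chosen of order at least \<open>n\<close>.\<close>
  have "\<exists>b. \<forall>i\<in>{..<g}. b i \<in> lie_filtration g n \<and> p Z (?x i) = nilp_class g c (b i)"
    by (rule bchoice) (use low[OF Z x] in \<open>auto simp: nilp_filtration_def\<close>)
  then obtain b where b: "\<And>i. i < g \<Longrightarrow> b i \<in> lie_filtration g n"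
    "\<And>i. i < g \<Longrightarrow> p Z (?x i) = nilp_class g c (b i)"
    by auto
  have bc: "b i \<in> carrier (free_nonassoc g)" if "i < g" for i
    using b(1)[OF that] by (rule lie_filtration_closed(1))
  have "b i \<in> lie_filtration g (n + 1)" if "i < g" for i
  proof -
    have "vanishes_below (n + 2) ((conv (lie_series (b i)) (letter j) - conv (letter j) (lie_series (b i)))
        - (conv (lie_series (b j)) (letter i) - conv (letter i) (lie_series (b j))))"
      if i: "i < g" and j: "j < g" for i j
    proof -
      have double: "p U (p Y Z) \<in> nilp_filtration g c (n + 2)" if "U \<in> carrier L" "Y \<in> carrier L" for U Y
      proof -
        \<comment> \<open>Multiplication by \<open>U\<close> sends generators to order
          \<open>n\<close>, so it raises degrees by \<open>n - 1\<close>, and the inner product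
          already has order \<open>n\<close>. The bound \<open>3 \<le> n\<close> gives
          \<open>2 * n - 1 \<ge> n + 2\<close>.\<close>
        have "p U (p Y Z) \<in> nilp_filtration g c (n + (n - 1))"
          using that n(1) Z low x
          by (intro cpa_nilp_filtration[OF p[unfolded L_def]]) (auto simp: L_def)
        then show ?thesis by (rule closed_filt(2)) (use n(1) in simp)
      qed
      let ?f = "magma_prod (b i) (single 1 (Gen j)) + magma_prod (single 1 (Gen i)) (b j)"
      have f: "?f \<in> carrier (free_nonassoc g)"
        using i j bc by (auto intro!: free_nonassoc_closed(1,2))
      have "nilp_class g c ?f = p Z (?x i) \<otimes>\<^bsub>L\<^esub> ?x j \<oplus>\<^bsub>L\<^esub> ?x i \<otimes>\<^bsub>L\<^esub> p Z (?x j)"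
        using i j bc by (simp add: b(2) simps free_nonassoc_closed(2))
      also have "\<dots> = p Z (?x i \<otimes>\<^bsub>L\<^esub> ?x j)"
        using cpa_bracket_right[OF Z x x, OF i j] by simp
      also have "\<dots> = p (?x i) (p (?x j) Z) \<ominus>\<^bsub>L\<^esub> p (?x j) (p (?x i) Z)"
        using cpa_bracket_left[OF x x Z, OF i j] cpa_commute[OF Z mult_closed[OF x x], OF i j] by simp
      also have "\<dots> \<in> nilp_filtration g c (n + 2)"
        using i j by (intro closed_filt(4) double x)
      \<comment> \<open>Passing from the class to its representative requires
        \<open>n + 2 \<le> c + 1\<close>, that is \<open>n < c\<close>.\<close>
      finally have "?f \<in> lie_filtration g (n + 2)"
        using nilp_class_mem_filtration[OF f, of "n + 2" c] n(2) by simp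
      moreover have "lie_series ?f =
          (conv (lie_series (b i)) (letter j) - conv (letter j) (lie_series (b i)))
          + (conv (letter i) (lie_series (b j)) - conv (lie_series (b j)) (letter i))"
      proof -
        have "magma_prod (b i) (single 1 (Gen j)) \<in> carrier (free_nonassoc g)"
          "magma_prod (single 1 (Gen i)) (b j) \<in> carrier (free_nonassoc g)"
          using i j bc by (auto intro!: free_nonassoc_closed(2))
        then show ?thesis
          using lie_series_gen(1)[OF bc[OF i] j] lie_series_gen(2)[OF bc[OF j] i]
          by (simp only: free_nonassoc_carrier lie_series_add)
      qed
      ultimately show ?thesis by (simp add: lie_filtration_def algebra_simps)
    qed
    moreover have "vanishes_below n (lie_series (b i))" if "i < g" for i
      using b(1)[OF that] by (simp add: lie_filtration_def)
    ultimately have "vanishes_below (n + 1) (lie_series (b i))"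
      using g n(1) that by (intro commutator_system_trivial[of g n "\<lambda>i. lie_series (b i)"]) auto
    then show ?thesis using bc[OF that] by (simp add: lie_filtration_def)
  qed
  \<comment> \<open>The gain on generators extends to every \<open>Y\<close>, because the derivation
    property is applied with the whole algebra as first step of the filtration.\<close>
  then have "p Z (?x i) \<in> nilp_filtration g c (Suc n)" if "i < g" for i
    using that b(2) by (simp add: nilp_filtration_def)
  then have "p Z Y \<in> nilp_filtration g c (1 + n)"
    using p Z Y by (intro cpa_nilp_filtration[where p = p])
      (auto simp: L_def nilp_filtration_1[unfolded One_nat_def])
  then show ?thesis by simp
qed

text \<open>The product preserves the fourth filtration step, the kernel of the projection to
  F_{g,3}, so it descends there and is central by hypothesis. Commuting with all generators up to
  order 4 then forces order 3.\<close>

lemma cpa_filtration_base: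
  fixes g c :: nat and p :: "(nat magma \<Rightarrow> 'k::field_char_0) set set \<Rightarrow> _"
  defines "L \<equiv> free_nilpotent_lie g c :: ('k, _) module"
    and "M \<equiv> free_nilpotent_lie g 3 :: ('k, _) module"
  assumes g: "g \<ge> 3" and c: "c \<ge> 3" and p: "cpa_structure L p"
    and central: "\<And>q. cpa_structure M q \<Longrightarrow> central_cpa M q"
    and U: "U \<in> carrier L" and Y: "Y \<in> carrier L"
  shows "p U Y \<in> nilp_filtration g c 3"
proof -
  interpret L: cpa_structure L p by (rule p)
  note simps = free_nilpotent_lie_simps[where g = g and c = c and 'k = 'k, folded L_def]
    and simps3 = free_nilpotent_lie_simps[where g = g and c = 3 and 'k = 'k, folded M_def]
  \<comment> \<open>\<open>\<rho>\<close> is the projection to F_{g,3}, independent of the chosen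
    representative because \<open>c \<ge> 3\<close>. \<open>\<sigma>\<close> below is an arbitrary
    section of it, not assumed linear, and serves only to define the induced product
    \<open>q\<close>.\<close>
  define \<rho> where "\<rho> U = nilp_class g 3 (SOME f :: nat magma \<Rightarrow> 'k. f \<in> carrier (free_nonassoc g) \<and> nilp_class g c f = U)" for U
  define \<sigma> where "\<sigma> C = nilp_class g c (SOME f :: nat magma \<Rightarrow> 'k. f \<in> carrier (free_nonassoc g) \<and> nilp_class g 3 f = C)" for C
  define q where "q = (\<lambda>C D. \<rho> (p (\<sigma> C) (\<sigma> D)))"
  have cls: "nilp_class g c (f :: nat magma \<Rightarrow> 'k) \<in> carrier L" if "f \<in> carrier (free_nonassoc g)" for f
    using that by (simp add: simps)
  have \<rho>: "\<rho> (nilp_class g c f) = nilp_class g 3 f" if f: "f \<in> carrier (free_nonassoc g)" for f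
  proof -
    define h where "h = (SOME h. h \<in> carrier (free_nonassoc g) \<and> nilp_class g c h = nilp_class g c f)"
    have h: "h \<in> carrier (free_nonassoc g) \<and> nilp_class g c h = nilp_class g c f"
      unfolding h_def by (rule someI[of _ f]) (use f in simp)
    then have "h - f \<in> lie_filtration g (c + 1)" using f simps(6) by blast
    then have "h - f \<in> lie_filtration g (3 + 1)" by (rule lie_filtration_closed(2)) (use c in simp)
    then have "nilp_class g 3 h = nilp_class g 3 f" using f h simps3(6) by blast
    then show ?thesis by (simp add: \<rho>_def h_def)
  qed
  have \<sigma>: "\<exists>h \<in> lie_filtration g 4. \<sigma> (nilp_class g 3 f) = nilp_class g c f \<oplus>\<^bsub>L\<^esub> nilp_class g c h"
    if f: "f \<in> carrier (free_nonassoc g)" for f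
  proof -
    define h where "h = (SOME h. h \<in> carrier (free_nonassoc g) \<and> nilp_class g 3 h = nilp_class g 3 f)"
    have h: "h \<in> carrier (free_nonassoc g) \<and> nilp_class g 3 h = nilp_class g 3 f"
      unfolding h_def by (rule someI[of _ f]) (use f in simp)
    then have "h - f \<in> lie_filtration g (3 + 1)" using f simps3(6) by blast
    moreover have "\<sigma> (nilp_class g 3 f) = nilp_class g c f \<oplus>\<^bsub>L\<^esub> nilp_class g c (h - f)"
      using f h by (simp add: \<sigma>_def h_def[symmetric] simps(3) free_nonassoc_closed(4))
    ultimately show ?thesis by (intro bexI[of _ "h - f"]) simp_all
  qed
  have \<rho>_add: "\<rho> (A \<oplus>\<^bsub>L\<^esub> B) = \<rho> A \<oplus>\<^bsub>M\<^esub> \<rho> B" if "A \<in> carrier L" "B \<in> carrier L" for A B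
    using that by (auto simp: simps(1) simps(3) simps3(3) \<rho> free_nonassoc_closed(1))
  have \<rho>_closed: "\<rho> A \<in> carrier M" if "A \<in> carrier L" for A
    using that by (auto simp: simps(1) simps3(1) \<rho>)
  interpret M: lie_algebra M unfolding M_def by (rule lie_algebra_free_nilpotent_lie)
  have \<rho>_kernel: "\<rho> (A \<oplus>\<^bsub>L\<^esub> B) = \<rho> A" if A: "A \<in> carrier L" and B: "B \<in> nilp_filtration g c 4" for A B
  proof -
    obtain h where h: "B = nilp_class g c h" "h \<in> lie_filtration g 4" using B by (auto simp: nilp_filtration_def)
    have "nilp_class g 3 h = \<zero>\<^bsub>M\<^esub>"
      using h(2) lie_filtration_closed(1)[OF h(2)] by (simp add: simps3(2) simps3(6))
    moreover have "B \<in> carrier L" using h lie_filtration_closed(1) cls by blast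
    ultimately show ?thesis
      using A \<rho>_add[of A B] \<rho>[OF lie_filtration_closed(1)[OF h(2)]] h(1) \<rho>_closed[OF A] by simp
  qed
  \<comment> \<open>The case \<open>m = 0\<close> of the degree estimate, whose condition on
    generators holds trivially.\<close>
  have stable: "p A B \<in> nilp_filtration g c 4" if "A \<in> carrier L" "B \<in> nilp_filtration g c 4" for A B
  proof -
    have "p A B \<in> nilp_filtration g c (4 + 0)"
    proof (rule cpa_nilp_filtration[where p = p])
      show "p A (nilp_class g c (single 1 (Gen i))) \<in> nilp_filtration g c (Suc 0)" if "i < g" for i
        using L.cpa_closed[OF \<open>A \<in> carrier L\<close> cls, of "single 1 (Gen i)"] that
          nilp_filtration_1[of g c, where 'k='k] by (simp add: L_def)
    qed (use p that in \<open>simp_all add: L_def\<close>)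
    then show ?thesis by simp
  qed
  have q: "q (\<rho> A) (\<rho> B) = \<rho> (p A B)" if A: "A \<in> carrier L" and B: "B \<in> carrier L" for A B
  proof -
    \<comment> \<open>The section returns the original element up to a correction in the fourth
      step. After expansion every term with a correction lies in that step and is killed by
      \<open>\<rho>\<close>.\<close>
    have lift: "\<exists>k. k \<in> nilp_filtration g c 4 \<and> k \<in> carrier L \<and> \<sigma> (\<rho> A) = A \<oplus>\<^bsub>L\<^esub> k"
      if A: "A \<in> carrier L" for A
    proof -
      obtain f where f: "A = nilp_class g c f" "f \<in> carrier (free_nonassoc g)"
        using A by (auto simp: simps(1))
      obtain h where h: "h \<in> lie_filtration g 4"
        "\<sigma> (nilp_class g 3 f) = nilp_class g c f \<oplus>\<^bsub>L\<^esub> nilp_class g c h"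
        using \<sigma>[OF f(2)] by blast
      have "nilp_class g c h \<in> carrier L" using h(1) by (intro cls lie_filtration_closed(1))
      with h f show ?thesis by (auto simp: \<rho> nilp_filtration_def)
    qed
    from lift[OF A] obtain k where k: "k \<in> nilp_filtration g c 4" "k \<in> carrier L" "\<sigma> (\<rho> A) = A \<oplus>\<^bsub>L\<^esub> k" by blast
    from lift[OF B] obtain l where l: "l \<in> nilp_filtration g c 4" "l \<in> carrier L" "\<sigma> (\<rho> B) = B \<oplus>\<^bsub>L\<^esub> l" by blast
    have Bl: "B \<oplus>\<^bsub>L\<^esub> l \<in> carrier L" using B l by simp
    have "p (A \<oplus>\<^bsub>L\<^esub> k) (B \<oplus>\<^bsub>L\<^esub> l) = (p A B \<oplus>\<^bsub>L\<^esub> p A l) \<oplus>\<^bsub>L\<^esub> p (B \<oplus>\<^bsub>L\<^esub> l) k"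
      using L.cpa_add_left[OF A k(2) Bl] L.cpa_add_right[OF A B l(2)] L.cpa_commute[OF k(2) Bl] by simp
    then have "q (\<rho> A) (\<rho> B) = \<rho> ((p A B \<oplus>\<^bsub>L\<^esub> p A l) \<oplus>\<^bsub>L\<^esub> p (B \<oplus>\<^bsub>L\<^esub> l) k)"
      by (simp add: q_def k l)
    also have "\<dots> = \<rho> (p A B)"
      using stable[OF A l(1)] stable[OF Bl k(1)] A B l(2)
      by (simp add: \<rho>_kernel L.cpa_closed)
    finally show ?thesis .
  qed
  have "cpa_structure M q"
  proof (rule cpa_structure_surjective_image[OF p M.lie_algebra_axioms, where \<rho> = \<rho>])
    show "carrier M = \<rho> ` carrier L" by (force simp: simps(1) simps3(1) \<rho>)
    show "\<rho> (x \<otimes>\<^bsub>L\<^esub> y) = \<rho> x \<otimes>\<^bsub>M\<^esub> \<rho> y" if "x \<in> carrier L" "y \<in> carrier L" for x y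
      using that by (auto simp: simps(1) simps(4) simps3(4) \<rho> free_nonassoc_closed(2))
    show "\<rho> (a \<odot>\<^bsub>L\<^esub> x) = a \<odot>\<^bsub>M\<^esub> \<rho> x" if "x \<in> carrier L" for a x
      using that by (auto simp: simps(1) simps(5) simps3(5) \<rho> free_nonassoc_closed(3))
  qed (fact \<rho>_add q)+
  then have "q (\<rho> U) (\<rho> Y) \<in> center M"
    using central[of q] U Y \<rho>_closed by (simp add: central_cpa_def)
  then have center: "\<rho> (p U Y) \<in> center M" using q U Y by simp
  obtain f where f: "p U Y = nilp_class g c f" "f \<in> carrier (free_nonassoc g)"
    using L.cpa_closed[OF U Y] by (auto simp: simps(1))
  \<comment> \<open>Centrality in F_{g,3} says that the bracket with each generator is zero there,
    which means order at least 4 for representatives.\<close>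
  have comm: "magma_prod f (single 1 (Gen i)) \<in> lie_filtration g 4" if i: "i < g" for i
  proof -
    have x: "single (1 :: 'k) (Gen i) \<in> carrier (free_nonassoc g)" using i by simp
    have "nilp_class g 3 f \<otimes>\<^bsub>M\<^esub> nilp_class g 3 (single 1 (Gen i)) = \<zero>\<^bsub>M\<^esub>"
      using center x by (auto simp: center_def f \<rho> simps3(1))
    then have "nilp_class g 3 (magma_prod f (single 1 (Gen i))) = nilp_class g 3 0"
      using f x by (simp add: simps3(2) simps3(4))
    then show ?thesis using f x by (simp add: simps3(6) free_nonassoc_closed(2))
  qed
  \<comment> \<open>The order rises from 1 to 2 and then to 3; these two steps need brackets of
    order 3 and 4.\<close>
  have "f \<in> lie_filtration g 1" using f by (simp only: lie_filtration_1)
  then have "f \<in> lie_filtration g (1 + 1)"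
    by (rule lie_series_centralizer[OF g order_refl])
      (rule lie_filtration_closed(2)[OF comm], simp_all)
  then have "f \<in> lie_filtration g 2" by (simp add: numeral_2_eq_2)
  then have "f \<in> lie_filtration g (2 + 1)"
    by (rule lie_series_centralizer[OF g one_le_numeral])
      (rule lie_filtration_closed(2)[OF comm], simp_all)
  then show ?thesis by (simp add: f nilp_filtration_def)
qed

text \<open>A bracket with any element raises the order to \<open>c + 1\<close>, where classes are
  zero.\<close>

lemma nilp_filtration_center:
  "nilp_filtration g c c \<subseteq> center (free_nilpotent_lie g c :: ('k::field_char_0, _) module)"
proof
  fix U :: "(nat magma \<Rightarrow> 'k) set set"
  assume "U \<in> nilp_filtration g c c"
  then obtain f where f: "U = nilp_class g c f" "f \<in> lie_filtration g c"
    by (auto simp: nilp_filtration_def)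
  have fc: "f \<in> carrier (free_nonassoc g)" using f(2) by (rule lie_filtration_closed(1))
  have "U \<otimes>\<^bsub>free_nilpotent_lie g c\<^esub> Y = \<zero>\<^bsub>free_nilpotent_lie g c\<^esub>"
    if Y: "Y \<in> carrier (free_nilpotent_lie g c)" for Y
  proof -
    obtain h where h: "Y = nilp_class g c h" "h \<in> lie_filtration g 1"
      using Y unfolding free_nilpotent_lie_simps(1) lie_filtration_1 by blast
    have "magma_prod f h \<in> lie_filtration g (c + 1)" using f(2) h(2) by (rule lie_filtration_closed(6))
    then show ?thesis
      using fc h(2)[unfolded lie_filtration_1]
      by (simp add: f h free_nilpotent_lie_simps free_nonassoc_closed(2))
  qed
  with fc f show "U \<in> center (free_nilpotent_lie g c)"
    by (simp add: center_def free_nilpotent_lie_simps(1))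
qed

theorem corollary4p8:
  fixes g :: nat
  assumes "g \<ge> 3"
    and "\<forall>p. cpa_structure (free_nilpotent_lie g 3 :: ('k::field_char_0, _) module) p \<longrightarrow>
           central_cpa (free_nilpotent_lie g 3 :: ('k, _) module) p"
  shows "\<forall>c\<ge>3. \<forall>p. cpa_structure (free_nilpotent_lie g c :: ('k, _) module) p \<longrightarrow>
           central_cpa (free_nilpotent_lie g c :: ('k, _) module) p"
proof (intro allI impI)
  fix c :: nat and p
  let ?L = "free_nilpotent_lie g c :: ('k, _) module"
  assume c: "3 \<le> c" and p: "cpa_structure ?L p"
  \<comment> \<open>The order of all products is raised one step at a time from 3 to
    \<open>c\<close>, where the filtration lies in the center.\<close>
  have "\<forall>U\<in>carrier ?L. \<forall>Y\<in>carrier ?L. p U Y \<in> nilp_filtration g c n"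
    if "3 \<le> n" "n \<le> c" for n
    using that
  proof (induction rule: dec_induct)
    case base
    show ?case
      by (intro ballI cpa_filtration_base[OF assms(1) c p]) (use assms(2) in auto)
  next
    case (step n)
    then show ?case using cpa_filtration_step[OF assms(1) _ _ p, of n] by auto
  qed
  from this[OF c order_refl] show "central_cpa ?L p"
    using nilp_filtration_center by (fastforce simp: central_cpa_def)
qed

end
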